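(* Let $a,b\ge 0$ be integers, and put $m=b-a-1$, $n=(a+2)(b+1)$ and $$A_{m,n}=\begin{pmatrix}0&1&0\\0&0&1\\1&-m&-n\end{pmatrix}.$$ Consider the sail of the two-dimensional continued fraction associated to $A_{m,n}$ that lies in the orthant containing the point $(0,0,1)$. Let $A=(1,0,a+2)$, $B=(0,0,1)$, $C=(b-a-1,1,0)$, $D=((b+1)^2,b+1,1)$. Then the following set of faces forms a fundamental domain of this sail: the vertex $A$; the (open) edges $AB$, $AD$, $BD$; and the (open) triangular faces $ABD$ and $BDC$.
   Context: For an operator $M\in SL(3,\mathbb Z)$ with real pairwise distinct eigenvalues and irreducible characteristic polynomial, the three planes spanned by pairs of eigenvectors divide $\mathbb R^3$ into $8$ open orthants; the sail of an orthant is the boundary of the convex hull of all integer points other than the origin in the closure of the orthant, and the set of the $8$ sails is the continued fraction associated to $M$. $\bar\Xi(M)$ denotes the group of integer matrices of determinant $1$ commuting with $M$ and having all eigenvalues positive real; it maps each sail onto itself. A fundamental domain of a sail is a union of faces of the sail containing exactly one face from each orbit of $\bar\Xi(M)$ acting on the faces of the sail. *)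

theory Defs
  imports "HOL-Analysis.Analysis" "HOL-Computational_Algebra.Computational_Algebra"
begin

text \<open>Operators in \<open>SL(3,\<int>)\<close> are integer matrices, acting on \<open>\<real>\<^sup>3\<close> through
  \<open>map_matrix real_of_int\<close>.\<close>

definition charpoly :: "'a::comm_ring_1^3^3 \<Rightarrow> 'a poly" where
  "charpoly M = det (mat [:0, 1:] - map_matrix (\<lambda>x. [:x:]) M)"

definition cf_operator :: "int^3^3 \<Rightarrow> bool" where
  "cf_operator M \<longleftrightarrow> det M = 1 \<and>
     card {x::real. poly (map_poly of_int (charpoly M)) x = 0} = 3 \<and>
     irreducible (map_poly rat_of_int (charpoly M))"

definition eigenvector :: "int^3^3 \<Rightarrow> real^3 \<Rightarrow> bool" where
  "eigenvector M v \<longleftrightarrow> v \<noteq> 0 \<and> (\<exists>l::real. map_matrix real_of_int M *v v = l *\<^sub>R v)"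

definition eigenplanes :: "int^3^3 \<Rightarrow> (real^3) set set" where
  "eigenplanes M = {span {v, w} | v w. eigenvector M v \<and> eigenvector M w \<and> w \<notin> span {v}}"

definition orthants :: "int^3^3 \<Rightarrow> (real^3) set set" where
  "orthants M = components (- \<Union>(eigenplanes M))"

text \<open>The orthant containing \<open>p\<close>; empty if \<open>p\<close> lies on one of the planes.\<close>

definition orthant_at :: "int^3^3 \<Rightarrow> real^3 \<Rightarrow> (real^3) set" where
  "orthant_at M p = connected_component_set (- \<Union>(eigenplanes M)) p"

lemma orthant_at_eq_iff:
  "p \<notin> \<Union>(eigenplanes M) \<and> Q = orthant_at M p \<longleftrightarrow> Q \<in> orthants M \<and> p \<in> Q"
proof
  assume "p \<notin> \<Union>(eigenplanes M) \<and> Q = orthant_at M p"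
  then show "Q \<in> orthants M \<and> p \<in> Q"
    unfolding orthants_def orthant_at_def by (auto simp: components_def connected_component_refl_eq)
next
  assume Q: "Q \<in> orthants M \<and> p \<in> Q"
  then have "p \<notin> \<Union>(eigenplanes M)"
    unfolding orthants_def using in_components_subset by blast
  moreover have "Q = orthant_at M p"
    using Q unfolding orthants_def orthant_at_def components_def
    by (auto intro: connected_component_trans connected_component_sym)
  ultimately show "p \<notin> \<Union>(eigenplanes M) \<and> Q = orthant_at M p" by blast
qed

definition integer_points :: "(real^3) set" where
  "integer_points = {p. \<forall>i. p $ i \<in> \<int>}"

definition sail_hull :: "(real^3) set \<Rightarrow> (real^3) set" where
  "sail_hull Q = convex hull (integer_points \<inter> closure Q - {0})"

definition sail :: "(real^3) set \<Rightarrow> (real^3) set" where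
  "sail Q = frontier (sail_hull Q)"

text \<open>Faces of all dimensions (vertices, edges, two-dimensional faces) are taken relatively
  open, so that they partition the sail; a vertex is its own relative interior.\<close>

definition sail_faces :: "(real^3) set \<Rightarrow> (real^3) set set" where
  "sail_faces Q = {rel_interior F | F. F face_of sail_hull Q \<and> F \<noteq> {} \<and> F \<subseteq> sail Q}"

definition Xi_bar :: "int^3^3 \<Rightarrow> (int^3^3) set" where
  "Xi_bar M = {N. det N = 1 \<and> N ** M = M ** N \<and>
     (\<forall>z::complex. poly (map_poly of_int (charpoly N)) z = 0 \<longrightarrow> z \<in> \<real> \<and> 0 < Re z)}"

definition face_orbit :: "int^3^3 \<Rightarrow> (real^3) set \<Rightarrow> (real^3) set set" where
  "face_orbit M F = {(\<lambda>x. map_matrix real_of_int N *v x) ` F | N. N \<in> Xi_bar M}"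

definition fundamental_domain :: "int^3^3 \<Rightarrow> (real^3) set \<Rightarrow> (real^3) set \<Rightarrow> bool" where
  "fundamental_domain M Q X \<longleftrightarrow>
     (\<exists>\<F> \<subseteq> sail_faces Q. X = \<Union>\<F> \<and>
        (\<forall>F \<in> sail_faces Q. \<exists>!G. G \<in> \<F> \<and> G \<in> face_orbit M F))"

definition A_mat :: "int \<Rightarrow> int \<Rightarrow> int^3^3" where
  "A_mat m n = vector [vector [0, 1, 0], vector [0, 0, 1], vector [1, -m, -n]]"

lemma charpoly_A_mat: "charpoly (A_mat m n) = [:-1, m, n, 1:]"
  by (simp add: charpoly_def A_mat_def det_3 mat_def)

lemma cf_operator_A_mat:
  fixes a b :: int
  assumes "0 \<le> a" "0 \<le> b" and m: "m = b - a - 1" and n: "n = (a + 2) * (b + 1)"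
  shows "cf_operator (A_mat m n)"
proof -
  have ab: "0 \<le> a * b" using assms by simp
  have pos1: "n + m > 0" and pos2: "n - m - 2 > 0"
    using assms(1,2) ab unfolding m n distrib_left distrib_right by linarith+
  have "det (A_mat m n) = 1"
    by (simp add: A_mat_def det_3)
  moreover have "card {x::real. poly (map_poly of_int (charpoly (A_mat m n))) x = 0} = 3"
  proof -
    define p :: "real poly" where "p = [:-1, of_int m, of_int n, 1:]"
    have p: "map_poly of_int (charpoly (A_mat m n)) = p"
      by (simp add: charpoly_A_mat p_def map_poly_pCons)
    have v0: "poly p 0 < 0" by (simp add: p_def)
    have v1: "poly p 1 > 0"
      using pos1 by (simp add: p_def flip: of_int_add)
    have v2: "poly p (-1) > 0"
    proof -
      have "poly p (-1) = of_int (n - m - 2)" by (simp add: p_def)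
      then show ?thesis using pos2 by simp
    qed
    define N where "N = - real_of_int (n + \<bar>m\<bar> + 2)"
    have npos: "n \<ge> 1" using pos1 pos2 by linarith
    have N1: "N < -1" using npos by (simp add: N_def)
    have v3: "poly p N < 0"
    proof -
      define t where "t = n + \<bar>m\<bar> + 2"
      have t: "t \<ge> 3" using npos by (simp add: t_def)
      have "poly p N = of_int (- 1 - m * t + n * t^2 - t^3)"
        by (simp add: p_def N_def t_def power2_eq_square power3_eq_cube algebra_simps)
      moreover have "- 1 - m * t + n * t^2 - t^3 = -1 - t * (m + t * (\<bar>m\<bar> + 2))"
        by (simp add: t_def power2_eq_square power3_eq_cube algebra_simps)
      moreover have "\<bar>m\<bar> + 2 \<le> t * (\<bar>m\<bar> + 2)" using t by (simp add: mult_le_cancel_right1)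
      then have "0 \<le> t * (m + t * (\<bar>m\<bar> + 2))" using t by (intro mult_nonneg_nonneg) linarith+
      ultimately show ?thesis by (smt (verit) of_int_less_0_iff)
    qed
    obtain x where x: "N < x" "x < -1" "poly p x = 0"
      using poly_IVT_pos[OF N1 v3 v2] by blast
    obtain y where y: "-1 < y" "y < 0" "poly p y = 0"
      using poly_IVT_neg[of "-1" 0 p] v2 v0 by auto
    obtain z where z: "0 < z" "z < 1" "poly p z = 0"
      using poly_IVT_pos[of 0 1 p] v1 v0 by auto
    have p0: "p \<noteq> 0" by (simp add: p_def)
    have "degree p = 3" by (simp add: p_def)
    then have "card {x. poly p x = 0} \<le> 3"
      using card_poly_roots_bound[OF p0] by simp
    moreover have "{x, y, z} \<subseteq> {x. poly p x = 0}" using x y z by auto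
    then have "card {x, y, z} \<le> card {x. poly p x = 0}"
      using poly_roots_finite[OF p0] by (intro card_mono)
    moreover have "card {x, y, z} = 3" using x y z by auto
    ultimately show ?thesis unfolding p by simp
  qed
  moreover have "irreducible (map_poly rat_of_int (charpoly (A_mat m n)))"
  proof -
    define p :: "rat poly" where "p = [:-1, of_int m, of_int n, 1:]"
    have p: "map_poly of_int (charpoly (A_mat m n)) = p"
      by (simp add: charpoly_A_mat p_def map_poly_pCons)
    have deg: "degree p = 3" by (simp add: p_def)
    have noroot: "poly p x \<noteq> 0" for x
    proof
      assume x: "poly p x = 0"
      have "algebraic_int x"
      proof (rule algebraic_int.intros)
        show "lead_coeff p = 1" by (simp add: p_def)
        show "\<forall>i. coeff p i \<in> \<int>"
          by (auto simp: p_def coeff_pCons split: nat.split)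
      qed (fact x)
      moreover have "x \<in> \<rat>"
        using Rats_of_rat[of x, where ?'a = rat] by simp
      ultimately have "x \<in> \<int>" by (rule rational_algebraic_int_is_int)
      then obtain k where k: "x = of_int k" by (elim Ints_cases)
      have "rat_of_int (-1 + k * (m + k * (n + k))) = 0"
        using x by (simp add: p_def k)
      then have eq: "k * (m + k * (n + k)) = 1" by (simp only: of_int_eq_0_iff)
      then have "k = 1 \<or> k = -1" using zmult_eq_1_iff by blast
      then show False using eq pos1 pos2 by auto
    qed
    have lin: False if pqr: "p = q * r" and q1: "degree q = 1" for q r
    proof -
      obtain c d where "q = [:c, d:]" "d \<noteq> 0"
        using degree1_coeffs[OF q1] by metis
      then have "poly q (- c / d) = 0" by simp
      then show False using noroot[of "- c / d"] pqr by simp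
    qed
    have "irreducible p"
    proof (rule irreducibleI)
      show p0: "p \<noteq> 0" using deg by auto
      show "\<not> p dvd 1" using deg is_unit_iff_degree[OF p0] by simp
      fix q r assume qr: "p = q * r"
      then have nz: "q \<noteq> 0" "r \<noteq> 0" using deg by auto
      have "degree q + degree r = 3" using deg qr nz by (simp add: degree_mult_eq)
      moreover have "degree q \<noteq> 1" using lin qr by blast
      moreover have "degree r \<noteq> 1" using lin[of r q] qr by (auto simp: mult.commute)
      ultimately have "degree q = 0 \<or> degree r = 0" by linarith
      then show "q dvd 1 \<or> r dvd 1" using nz by (auto simp: is_unit_iff_degree)
    qed
    then show ?thesis unfolding p .
  qed
  ultimately show ?thesis unfolding cf_operator_def by blast
qed

end

theory Submission
  imports Defs
begin

text \<open>
Sending the point \<open>(x, y, z)\<close> to \<open>x t + y (t\<^sup>2 - m t) + z\<close>, where \<open>1/t\<close> is an eigenvalue, turns the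
lattice into \<open>\<int>[t]\<close> and the action of the group into multiplication by units; the three
conjugates of this number are positive exactly on the orthant of \<open>B\<close>. Under this identification
\<open>B = 1\<close>, \<open>C = \<alpha>\<close>, \<open>A = \<beta>\<close> and \<open>D = \<alpha> \<beta>\<close> for the totally positive units \<open>\<alpha> = t\<^sup>2\<close> and
\<open>\<beta> = t + a + 2\<close>, so that translates of the triangles \<open>ABD\<close> and \<open>BDC\<close> are glued along
their edges like a triangulated torus.

The plane of \<open>ABD\<close> is a level set \<open>ell1 = 1\<close> of an integer functional that is positive on the
closed orthant. Applying \<open>ell1 \<ge> 1\<close> also to translates of an integer point yields
\<open>ell2 \<ge> a + 2\<close> for the functional \<open>ell2\<close> that equals \<open>a + 2\<close> on the plane of \<open>BDC\<close>, together with
the equality cases of both bounds; hence both triangles are faces. Conversely, for a point of the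
hull choose the translate of \<open>ell1\<close> or \<open>ell2 / (a + 2)\<close> with the smallest value at it. Comparison
with the three neighbouring triangles shows that the point lies in the cone over the corresponding
triangle, so a boundary point lies in the triangle itself.
\<close>

section \<open>Matrices, faces and simplices\<close>

no_notation fps_nth (infixl "$" 75)

abbreviation act :: "int^3^3 \<Rightarrow> real^3 \<Rightarrow> real^3" where
  "act N x \<equiv> map_matrix real_of_int N *v x"

lemma act_mult: "act (M ** N) x = act M (act N x)"
  by (simp add: vec_eq_iff matrix_matrix_mult_def matrix_vector_mult_def forall_3 sum_3 algebra_simps)

lemma act_one: "act (mat 1) x = x"
  by (simp add: vec_eq_iff mat_def matrix_vector_mult_def forall_3 sum_3)

text \<open>The inverse is the adjugate, written out by cofactors so that it stays over the ring of
  entries.\<close>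

lemma det_one_imp_inverse:
  fixes N :: "'a::comm_ring_1^3^3"
  assumes "det N = 1"
  obtains N' where "N ** N' = mat 1" "N' ** N = mat 1"
proof -
  define N' :: "'a^3^3" where "N' = vector
    [vector [N$2$2 * N$3$3 - N$2$3 * N$3$2, N$1$3 * N$3$2 - N$1$2 * N$3$3, N$1$2 * N$2$3 - N$1$3 * N$2$2],
     vector [N$2$3 * N$3$1 - N$2$1 * N$3$3, N$1$1 * N$3$3 - N$1$3 * N$3$1, N$1$3 * N$2$1 - N$1$1 * N$2$3],
     vector [N$2$1 * N$3$2 - N$2$2 * N$3$1, N$1$2 * N$3$1 - N$1$1 * N$3$2, N$1$1 * N$2$2 - N$1$2 * N$2$1]]"
  have "(N ** N') $ i $ j = mat (det N) $ i $ j" "(N' ** N) $ i $ j = mat (det N) $ i $ j" for i j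
    using exhaust_3[of i] exhaust_3[of j]
    by (auto simp: N'_def matrix_matrix_mult_def sum_3 mat_def det_3 algebra_simps)
  then have "N ** N' = mat (det N)" "N' ** N = mat (det N)" by (simp_all add: vec_eq_iff)
  then show ?thesis using assms that by simp
qed

text \<open>Embedding the coefficients and evaluating at \<open>z\<close> is a ring homomorphism,
  and the determinant is a polynomial in the entries.\<close>

lemma poly_charpoly:
  fixes z :: "'a::{comm_ring_1,ring_char_0}"
  shows "poly (map_poly of_int (charpoly N)) z = det (mat z - map_matrix of_int N)"
proof -
  define h :: "int poly \<Rightarrow> 'a poly" where "h = map_poly of_int"
  define e where "e p = poly (h p) z" for p
  have hadd: "h (p + q) = h p + h q" and hdiff: "h (p - q) = h p - h q" for p q
    by (auto simp: h_def coeff_map_poly intro!: poly_eqI)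
  have hmult: "h (p * q) = h p * h q" for p q
    by (induction p) (simp_all add: h_def map_poly_pCons map_poly_smult hadd[unfolded h_def])
  have hom: "e (p + q) = e p + e q" "e (p - q) = e p - e q" "e (p * q) = e p * e q" for p q
    by (simp_all add: e_def hadd hdiff hmult)
  have entry: "e ((mat [:0, 1:] - map_matrix (\<lambda>x. [:x:]) N) $ i $ j)
      = (mat z - map_matrix of_int N) $ i $ j" for i j
    by (simp add: mat_def e_def h_def map_poly_pCons)
  show ?thesis
    unfolding charpoly_def det_3 e_def[unfolded h_def, symmetric] by (simp only: hom entry)
qed

lemma subset_triple:
  assumes "V \<subseteq> {x, y, z}"
  shows "V = {} \<or> V = {x} \<or> V = {y} \<or> V = {z} \<or> V = {x, y} \<or> V = {x, z} \<or> V = {y, z} \<or> V = {x, y, z}"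
proof -
  have "V = (if x \<in> V then {x} else {}) \<union> (if y \<in> V then {y} else {}) \<union> (if z \<in> V then {z} else {})"
    using assms by auto
  then show ?thesis by (auto split: if_splits)
qed

lemma exposed_face_convex_hull:
  fixes S :: "'a::euclidean_space set"
  assumes "\<And>x. x \<in> S \<Longrightarrow> c \<le> w \<bullet> x"
  shows "convex hull (S \<inter> {x. w \<bullet> x = c}) face_of convex hull S"
proof -
  let ?S0 = "S \<inter> {x. w \<bullet> x = c}"
  \<comment> \<open>\<open>?K\<close> is convex because a proper mixture involving a point strictly
    above the hyperplane stays strictly above. It shows that the hull meets the hyperplane only in
    the hull of \<open>?S0\<close>.\<close>
  let ?K = "{x. w \<bullet> x > c} \<union> convex hull ?S0"
  have S0: "convex hull ?S0 \<subseteq> {x. w \<bullet> x = c}"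
    by (rule hull_minimal) (auto simp: convex_hyperplane)
  have "convex ?K"
  proof (rule convexI)
    fix x y and s t :: real
    assume xy: "x \<in> ?K" "y \<in> ?K" and st: "0 \<le> s" "0 \<le> t" "s + t = 1"
    show "s *\<^sub>R x + t *\<^sub>R y \<in> ?K"
    proof (cases "x \<in> convex hull ?S0 \<and> y \<in> convex hull ?S0")
      case True
      then show ?thesis using st convexD[OF convex_convex_hull] by blast
    next
      case False
      consider "s = 0" "t = 1" | "t = 0" "s = 1" | "s > 0" "t > 0" using st by fastforce
      then show ?thesis
      proof cases
        case 3
        have wx: "w \<bullet> x \<ge> c" and wy: "w \<bullet> y \<ge> c" and "w \<bullet> x > c \<or> w \<bullet> y > c"
          using xy S0 False by fastforce+
        then have "s * (w \<bullet> x - c) + t * (w \<bullet> y - c) > 0"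
          using 3 by (smt (verit) mult_nonneg_nonneg mult_pos_pos)
        moreover have "s * c + t * c = c" using st by (metis distrib_right mult_1)
        ultimately show ?thesis by (simp add: inner_add_right algebra_simps)
      qed (use xy in auto)
    qed
  qed
  moreover have "S \<subseteq> ?K" using assms by (force simp: hull_inc less_le)
  ultimately have HK: "convex hull S \<subseteq> ?K" by (rule hull_minimal[rotated])
  have "convex hull ?S0 = convex hull S \<inter> {x. w \<bullet> x = c}"
    using HK S0 hull_mono[of ?S0 S] by auto
  moreover have "convex hull S \<subseteq> {x. w \<bullet> x \<ge> c}"
    by (rule hull_minimal) (auto simp: assms convex_halfspace_ge)
  ultimately show ?thesis
    using face_of_Int_supporting_hyperplane_ge[OF convex_convex_hull[of S], of c w] by auto
qed

text \<open>Convex combinations inherit discreteness of the values of a family of linear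
  functionals: this replaces any growth estimate for the units when a minimum is needed.\<close>

lemma finite_values_convex_hull:
  fixes L :: "'i \<Rightarrow> 'a::real_vector \<Rightarrow> real"
  assumes lin: "\<And>i. i \<in> I \<Longrightarrow> linear (L i)"
    and nonneg: "\<And>i x. i \<in> I \<Longrightarrow> x \<in> S \<Longrightarrow> 0 \<le> L i x"
    and fin: "\<And>x K. x \<in> S \<Longrightarrow> finite {L i x | i. i \<in> I \<and> L i x \<le> K}"
    and x: "x \<in> convex hull S"
  shows "finite {L i x | i. i \<in> I \<and> L i x \<le> K}"
proof -
  \<comment> \<open>Nonnegativity is carried along with finiteness: it turns a bound on a convex
    combination into bounds on both summands.\<close>
  define D where "D = {x. (\<forall>i\<in>I. 0 \<le> L i x) \<and> (\<forall>K. finite {L i x | i. i \<in> I \<and> L i x \<le> K})}"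
  have "convex D"
  proof (rule convexI)
    fix x y and s t :: real
    assume xy: "x \<in> D" "y \<in> D" and st: "0 \<le> s" "0 \<le> t" "s + t = 1"
    have eq: "L i (s *\<^sub>R x + t *\<^sub>R y) = s * L i x + t * L i y" if "i \<in> I" for i
      using lin[OF that] by (simp add: linear_add linear_scale)
    consider "s = 0" "t = 1" | "t = 0" "s = 1" | "s > 0" "t > 0" using st by fastforce
    then show "s *\<^sub>R x + t *\<^sub>R y \<in> D"
    proof cases
      case 3
      have "finite {L i (s *\<^sub>R x + t *\<^sub>R y) | i. i \<in> I \<and> L i (s *\<^sub>R x + t *\<^sub>R y) \<le> K}" for K
      proof (rule finite_subset)
        let ?X = "{L i x | i. i \<in> I \<and> L i x \<le> K / s}" and ?Y = "{L i y | i. i \<in> I \<and> L i y \<le> K / t}"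
        show "finite ((\<lambda>(p, q). s * p + t * q) ` (?X \<times> ?Y))"
          using xy by (auto simp: D_def)
        show "{L i (s *\<^sub>R x + t *\<^sub>R y) | i. i \<in> I \<and> L i (s *\<^sub>R x + t *\<^sub>R y) \<le> K}
          \<subseteq> (\<lambda>(p, q). s * p + t * q) ` (?X \<times> ?Y)"
        proof clarify
          fix i assume i: "i \<in> I" and K: "L i (s *\<^sub>R x + t *\<^sub>R y) \<le> K"
          have "0 \<le> s * L i x" "0 \<le> t * L i y" using xy i st by (auto simp: D_def)
          then have "s * L i x \<le> K" "t * L i y \<le> K" using K eq[OF i] by linarith+
          then have "L i x \<le> K / s" "L i y \<le> K / t" using 3 by (auto simp: field_simps)
          then show "L i (s *\<^sub>R x + t *\<^sub>R y) \<in> (\<lambda>(p, q). s * p + t * q) ` (?X \<times> ?Y)"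
            using i eq[OF i] by (intro image_eqI[of _ _ "(L i x, L i y)"]) auto
        qed
      qed
      moreover have "0 \<le> L i (s *\<^sub>R x + t *\<^sub>R y)" if "i \<in> I" for i
        using xy that st by (auto simp: eq D_def)
      ultimately show ?thesis by (auto simp: D_def)
    qed (use xy in auto)
  qed
  then have "convex hull S \<subseteq> D"
    using nonneg fin by (intro hull_minimal) (auto simp: D_def)
  then show ?thesis using x by (auto simp: D_def)
qed

lemma independent_by_functionals:
  fixes S :: "'a::real_vector set"
  assumes "\<And>v. v \<in> S \<Longrightarrow> \<exists>f::'a \<Rightarrow> real. linear f \<and> f v \<noteq> 0 \<and> (\<forall>w \<in> S - {v}. f w = 0)"
  shows "independent S"
  unfolding dependent_def
proof clarify
  fix v assume v: "v \<in> S" "v \<in> span (S - {v})"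
  obtain f :: "'a \<Rightarrow> real" where f: "linear f" "f v \<noteq> 0" "\<forall>w \<in> S - {v}. f w = 0"
    using assms[OF v(1)] by blast
  then show False using linear_eq_0_on_span[of f "S - {v}" v] v by blast
qed

text \<open>\<open>V\<close> is the support of the barycentric coordinates of
  \<open>x\<close>.\<close>

lemma simplex_rel_interior_cases:
  fixes S :: "'a::euclidean_space set"
  assumes "\<not> affine_dependent S" "x \<in> convex hull S"
  obtains V where "V \<subseteq> S" "V \<noteq> {}" "x \<in> rel_interior (convex hull V)"
proof -
  have fin: "finite S" using assms(1) aff_independent_finite by blast
  obtain c where c: "\<forall>v\<in>S. 0 \<le> c v" "sum c S = 1" "(\<Sum>v\<in>S. c v *\<^sub>R v) = x"
    using assms(2) convex_hull_finite[OF fin] by auto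
  define V where "V = {v\<in>S. c v > 0}"
  have V: "V \<subseteq> S" by (auto simp: V_def)
  have zero: "\<forall>v\<in>S - V. c v = 0" using c(1) by (force simp: V_def)
  have 1: "sum c V = 1" using sum.mono_neutral_left[OF fin V zero] c(2) by simp
  have 2: "(\<Sum>v\<in>V. c v *\<^sub>R v) = x"
    using sum.mono_neutral_left[OF fin V, of "\<lambda>v. c v *\<^sub>R v"] zero c(3) by simp
  have "\<not> affine_dependent V" using assms(1) V affine_dependent_subset by blast
  then have "x \<in> rel_interior (convex hull V)"
    using 1 2 by (subst rel_interior_convex_hull_explicit) (auto simp: V_def intro!: exI[of _ c])
  then show ?thesis using that[OF V] 1 by fastforce
qed

text \<open>The closure recovers the simplex, whose extreme points are its vertices.\<close>

lemma rel_interior_simplex_determines_vertices: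
  fixes V W :: "'a::euclidean_space set"
  assumes "\<not> affine_dependent V" "\<not> affine_dependent W"
    and "rel_interior (convex hull V) = rel_interior (convex hull W)"
  shows "V = W"
proof -
  have "closure (rel_interior (convex hull X)) = convex hull X" if "\<not> affine_dependent X" for X :: "'a set"
    using that aff_independent_finite[OF that]
    by (simp add: convex_closure_rel_interior finite_imp_compact_convex_hull compact_imp_closed closure_closed)
  then have "convex hull V = convex hull W" using assms by metis
  then show ?thesis
    using extreme_point_of_convex_hull_affine_independent[OF assms(1)]
      extreme_point_of_convex_hull_affine_independent[OF assms(2)] by auto
qed

text \<open>With empty interior, the normal of a hyperplane containing \<open>S\<close> serves;
  otherwise interior and relative interior agree.\<close>

lemma supporting_functional:
  fixes S :: "'a::euclidean_space set"
  assumes "convex S" "x \<in> S" "x \<notin> interior S"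
  obtains w where "w \<noteq> 0" "\<And>y. y \<in> S \<Longrightarrow> w \<bullet> x \<le> w \<bullet> y"
proof (cases "interior S = {}")
  case True
  then obtain w c where "w \<noteq> 0" "S \<subseteq> {x. w \<bullet> x = c}"
    using empty_interior_subset_hyperplane[OF assms(1)] by blast
  then show ?thesis using that[of w] assms(2) by (metis (mono_tags) mem_Collect_eq order_refl subset_iff)
next
  case False
  then have "x \<notin> rel_interior S" using assms(3) by (simp add: rel_interior_nonempty_interior)
  then show ?thesis
    using supporting_hyperplane_rel_boundary[OF assms(1,2)] that by metis
qed

section \<open>The eigenfunctionals and the unit group\<close>

text \<open>Inversion of a Vandermonde matrix: \<open>f\<close>, \<open>g\<close>, \<open>h\<close>
  pair \<open>(x, y, z)\<close> with the coefficients of the monic quadratics whose roots are two of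
  \<open>p\<close>, \<open>q\<close>, \<open>r\<close>, so each annihilates two of the vectors
  \<open>(1, p, p^2)\<close>, \<open>(1, q, q^2)\<close>, \<open>(1, r, r^2)\<close>. Both real and
  complex coordinates are needed below.\<close>

lemma lagrange_coordinates:
  fixes x y z p q r :: "'a::field"
  assumes "p \<noteq> q" "p \<noteq> r" "q \<noteq> r"
  defines "f \<equiv> x * (q * r) - y * (q + r) + z"
    and "g \<equiv> x * (p * r) - y * (p + r) + z"
    and "h \<equiv> x * (p * q) - y * (p + q) + z"
    and "d \<equiv> (p - q) * (p - r)" and "e \<equiv> (q - p) * (q - r)" and "k \<equiv> (r - p) * (r - q)"
  shows "x = f / d + g / e + h / k"
    and "y = f / d * p + g / e * q + h / k * r"
    and "z = f / d * p^2 + g / e * q^2 + h / k * r^2"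
proof -
  \<comment> \<open>The Vandermonde product is a common denominator; once it is cleared, only
    polynomial identities remain.\<close>
  define v where "v = (p - q) * (p - r) * (q - r)"
  have nz: "v \<noteq> 0" "d \<noteq> 0" "e \<noteq> 0" "k \<noteq> 0"
    using assms(1-3) by (simp_all add: v_def d_def e_def k_def)
  have "f * v = f * (q - r) * d" "g * v = - g * (p - r) * e" "h * v = h * (p - q) * k"
    unfolding v_def d_def e_def k_def by algebra+
  then have quot: "f / d = f * (q - r) / v" "g / e = - g * (p - r) / v" "h / k = h * (p - q) / v"
    using nz by (metis frac_eq_eq)+
  have prod: "x * v = f * (q - r) - g * (p - r) + h * (p - q)"
      "y * v = f * (q - r) * p - g * (p - r) * q + h * (p - q) * r"
      "z * v = f * (q - r) * p^2 - g * (p - r) * q^2 + h * (p - q) * r^2"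
    unfolding f_def g_def h_def v_def by algebra+
  have "x = (f * (q - r) - g * (p - r) + h * (p - q)) / v"
      "y = (f * (q - r) * p - g * (p - r) * q + h * (p - q) * r) / v"
      "z = (f * (q - r) * p^2 - g * (p - r) * q^2 + h * (p - q) * r^2) / v"
    unfolding prod[symmetric] using nz(1) by simp_all
  then show "x = f / d + g / e + h / k"
    and "y = f / d * p + g / e * q + h / k * r"
    and "z = f / d * p^2 + g / e * q^2 + h / k * r^2"
    unfolding quot by (simp_all add: add_divide_distrib diff_divide_distrib)
qed

text \<open>The bounds say \<open>l1 < -1 < l2 < -1/(a+2)\<close> and
  \<open>0 < l3 < 1/(b+1)\<close>, without division. They decide the signs of the conjugates of
  \<open>beta\<close> and of the eigenbasis coefficients of \<open>ell1\<close>.\<close>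

locale sail_setup =
  fixes a b m n :: int and l1 l2 l3 :: real
  assumes a: "0 \<le> a" and b: "0 \<le> b"
    and m: "m = b - a - 1" and n: "n = (a + 2) * (b + 1)"
    and vieta: "of_int n = - (l1 + l2 + l3)" "of_int m = l1 * l2 + l1 * l3 + l2 * l3" "l1 * l2 * l3 = 1"
    and l1: "l1 < -1" and l2: "-1 < l2" "l2 * of_int (a + 2) < -1"
    and l3: "0 < l3" "l3 * of_int (b + 1) < 1"
begin

abbreviation "M \<equiv> A_mat m n"
abbreviation "R \<equiv> {l1, l2, l3}"

text \<open>A left eigenvector of \<open>M\<close> for a root \<open>l\<close>, normalised to 1 at
  \<open>B\<close>. With \<open>t = 1/l\<close> the first two coefficients are \<open>t\<close> and
  \<open>t^2 - m t\<close>.\<close>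

definition u :: "real \<Rightarrow> real^3 \<Rightarrow> real" where
  "u l x = x $ 1 * (l^2 + of_int n * l + of_int m) + x $ 2 * (l + of_int n) + x $ 3"

definition A :: "real^3" where "A = vector [1, 0, of_int (a + 2)]"
definition B :: "real^3" where "B = vector [0, 0, 1]"
definition C :: "real^3" where "C = vector [of_int (b - a - 1), 1, 0]"
definition D :: "real^3" where "D = vector [of_int ((b + 1)^2), of_int (b + 1), 1]"

lemmas vertex_defs = A_def B_def C_def D_def

text \<open>The orthant in explicit form; \<open>orthant_at_B\<close> identifies it with the
  topological definition.\<close>

definition orth :: "(real^3) set" where "orth = {x. \<forall>l\<in>R. 0 < u l x}"

lemma l2_neg: "l2 < 0"
proof (rule ccontr)
  assume "\<not> l2 < 0"
  then have "0 \<le> l2 * of_int (a + 2)" using a by simp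
  then show False using l2 by simp
qed

lemma distinct: "l1 \<noteq> l2" "l1 \<noteq> l3" "l2 \<noteq> l3"
  using l1 l2 l2_neg l3 by auto

lemma root: "l \<in> R \<Longrightarrow> l^3 + of_int n * l^2 + of_int m * l = 1"
  using vieta(3) unfolding vieta(1,2) by (auto simp: algebra_simps power2_eq_square power3_eq_cube)

lemma root_nonzero: "l \<in> R \<Longrightarrow> l \<noteq> 0"
  using l1 l2_neg l3 by auto

lemma linear_u: "linear (u l)"
  by (rule linearI) (simp_all add: u_def algebra_simps)

lemma u_B [simp]: "u l B = 1"
  by (simp add: u_def B_def)

text \<open>By Vieta, the coefficients of each \<open>u l\<close> come from the other two roots, the
  form required by \<open>lagrange_coordinates\<close>.\<close>

lemma u_expand:
  "u l1 x = x $ 1 * (l2 * l3) - x $ 2 * (l2 + l3) + x $ 3"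
  "u l2 x = x $ 1 * (l1 * l3) - x $ 2 * (l1 + l3) + x $ 3"
  "u l3 x = x $ 1 * (l1 * l2) - x $ 2 * (l1 + l2) + x $ 3"
  by (simp_all add: u_def vieta(1,2) algebra_simps power2_eq_square)

lemma coordinates:
  fixes x :: "real^3"
  defines "s \<equiv> u l1 x / ((l1 - l2) * (l1 - l3))" and "t \<equiv> u l2 x / ((l2 - l1) * (l2 - l3))"
    and "r \<equiv> u l3 x / ((l3 - l1) * (l3 - l2))"
  shows "x $ 1 = s + t + r" "x $ 2 = s * l1 + t * l2 + r * l3"
    "x $ 3 = s * l1^2 + t * l2^2 + r * l3^2"
  using lagrange_coordinates[OF distinct, where x = "x $ 1" and y = "x $ 2" and z = "x $ 3"]
  unfolding s_def t_def r_def u_expand by simp_all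

lemma u_act_M: "l \<in> R \<Longrightarrow> u l (act M x) = l * u l x"
proof -
  assume "l \<in> R"
  then have *: "l * (l\<^sup>2 + of_int n * l + of_int m) = 1"
    using root[of l] by (simp add: algebra_simps power2_eq_square power3_eq_cube)
  have "act M x = vector [x $ 2, x $ 3, x $ 1 - of_int m * x $ 2 - of_int n * x $ 3]"
    by (simp add: A_mat_def vec_eq_iff forall_3 matrix_vector_mult_def sum_3)
  then have "u l (act M x) - l * u l x = x $ 1 * (1 - l * (l\<^sup>2 + of_int n * l + of_int m))"
    by (simp add: u_def algebra_simps power2_eq_square)
  then show ?thesis using * by simp
qed

text \<open>A functional that is a left eigenvector of \<^term>\<open>M\<close> for \<open>l\<close> is a multiple of \<^term>\<open>u l\<close>.\<close>

lemma u_act: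
  assumes N: "N ** M = M ** N" and l: "l \<in> R"
  shows "u l (act N x) = u l (act N B) * u l x"
proof -
  define w where "w x = u l (act N x)" for x
  have lin: "linear w"
    unfolding w_def by (intro linear_compose[OF _ linear_u, unfolded o_def]) simp
  have wM: "w (act M x) = l * w x" for x
    unfolding w_def using u_act_M[OF l, of "act N x"] N by (metis act_mult)
  have ax: "act M (axis 1 1) = axis 3 1" "act M (axis 2 1) = axis 1 1 - of_int m *\<^sub>R axis 3 1"
     "act M (axis 3 1) = axis 2 1 - of_int n *\<^sub>R axis 3 1"
    by (simp_all add: A_mat_def vec_eq_iff forall_3 matrix_vector_mult_def sum_3 axis_def)
  \<comment> \<open>These relations, read off the columns of \<open>M\<close>, express all values of
    \<open>w\<close> through the one at \<open>axis 3 1\<close>, which is \<open>B\<close>.\<close>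
  have e: "w (axis 3 1) = l * w (axis 1 1)" "w (axis 1 1) - of_int m * w (axis 3 1) = l * w (axis 2 1)"
     "w (axis 2 1) - of_int n * w (axis 3 1) = l * w (axis 3 1)"
    using wM[of "axis 1 1"] wM[of "axis 2 1"] wM[of "axis 3 1"] unfolding ax
    by (simp_all add: linear_diff[OF lin] linear_scale[OF lin])
  have B: "B = axis 3 1" by (simp add: B_def vec_eq_iff forall_3 axis_def)
  have "x = x $ 1 *\<^sub>R axis 1 1 + x $ 2 *\<^sub>R axis 2 1 + x $ 3 *\<^sub>R axis 3 1"
    by (simp add: vec_eq_iff forall_3 axis_def)
  then have "w x = w (x $ 1 *\<^sub>R axis 1 1 + x $ 2 *\<^sub>R axis 2 1 + x $ 3 *\<^sub>R axis 3 1)" by simp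
  also have "\<dots> = x $ 1 * w (axis 1 1) + x $ 2 * w (axis 2 1) + x $ 3 * w (axis 3 1)"
    by (simp add: linear_add[OF lin] linear_scale[OF lin])
  finally have "w x = x $ 1 * w (axis 1 1) + x $ 2 * w (axis 2 1) + x $ 3 * w (axis 3 1)" .
  moreover have w2: "w (axis 2 1) = (l + of_int n) * w (axis 3 1)" using e(3) by (simp add: algebra_simps)
  moreover have "w (axis 1 1) = (l^2 + of_int n * l + of_int m) * w (axis 3 1)"
    using e(2) unfolding w2 by (simp add: algebra_simps power2_eq_square)
  ultimately have "w x = w (axis 3 1) * u l x" by (simp add: u_def algebra_simps)
  then show ?thesis by (simp add: w_def B)
qed

text \<open>This is \<open>u_act\<close> on the columns of \<open>N\<close>, as scalar equations
  that can be transferred to the complex numbers.\<close>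

lemma left_eigen:
  assumes "N ** M = M ** N" "l \<in> R"
  shows "(l^2 + of_int n * l + of_int m) * of_int (N $ 1 $ i) + (l + of_int n) * of_int (N $ 2 $ i) + of_int (N $ 3 $ i)
    = u l (act N B) * (if i = 1 then l^2 + of_int n * l + of_int m else if i = 2 then l + of_int n else 1)"
proof -
  have "u l (act N (axis i 1)) = u l (act N B) * u l (axis i 1)" by (rule u_act[OF assms])
  moreover have "act N (axis i 1) $ j = of_int (N $ j $ i)" for j
    by (simp add: matrix_vector_mult_def axis_def if_distrib sum.delta cong: if_cong)
  moreover have "u l (axis i 1) = (if i = 1 then l^2 + of_int n * l + of_int m else if i = 2 then l + of_int n else 1)"
    using exhaust_3[of i] by (auto simp: u_def axis_def)
  ultimately show ?thesis by (simp add: u_def[of l "act N (axis i 1)"] mult.commute)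
qed

text \<open>At an eigenvector \<open>x\<close> of \<open>N\<close> for \<open>z\<close>, the product
  of \<open>z - u l (act N B)\<close> with the complexified \<open>u l x\<close> is 0. If
  \<open>z\<close> is not positive real, the first factor is nonzero for every root, so all three
  functionals vanish at \<open>x\<close> and \<open>x = 0\<close>.\<close>

lemma Xi_barI:
  assumes "det N = 1" and N: "N ** M = M ** N" and pos: "\<And>l. l \<in> R \<Longrightarrow> 0 < u l (act N B)"
  shows "N \<in> Xi_bar M"
proof -
  have "z \<in> \<real> \<and> 0 < Re z" if z: "poly (map_poly of_int (charpoly N)) z = 0" for z :: complex
  proof (rule ccontr)
    assume nz: "\<not> (z \<in> \<real> \<and> 0 < Re z)"
    let ?Z = "mat z - map_matrix of_int N :: complex^3^3"
    have "x = 0" if x: "?Z *v x = 0" for x :: "complex^3"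
    proof -
      have row: "of_int (N $ i $ 1) * x $ 1 + of_int (N $ i $ 2) * x $ 2 + of_int (N $ i $ 3) * x $ 3 = z * x $ i" for i
      proof -
        have "(?Z *v x) $ i = 0" using x by simp
        then show ?thesis
          using exhaust_3[of i] by (auto simp: matrix_vector_mult_def sum_3 mat_def algebra_simps)
      qed
      have U: "x $ 1 * of_real (l^2 + of_int n * l + of_int m) + x $ 2 * of_real (l + of_int n) + x $ 3 = 0"
        (is "?U = 0") if l: "l \<in> R" for l
      proof -
        define g where "g = u l (act N B)"
        define c1 :: complex where "c1 = of_real (l^2 + of_int n * l + of_int m)"
        define c2 :: complex where "c2 = of_real (l + of_int n)"
        have e: "c1 * of_int (N $ 1 $ i) + c2 * of_int (N $ 2 $ i) + of_int (N $ 3 $ i)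
          = of_real g * (if i = 1 then c1 else if i = 2 then c2 else 1)" for i
          using arg_cong[OF left_eigen[OF N l, of i], of complex_of_real]
          by (auto simp: g_def c1_def c2_def split: if_splits)
        have "z * (x $ 1 * c1 + x $ 2 * c2 + x $ 3) = z * x $ 1 * c1 + z * x $ 2 * c2 + z * x $ 3"
          by (simp add: algebra_simps)
        also have "\<dots> = x $ 1 * (c1 * of_int (N $ 1 $ 1) + c2 * of_int (N $ 2 $ 1) + of_int (N $ 3 $ 1))
           + x $ 2 * (c1 * of_int (N $ 1 $ 2) + c2 * of_int (N $ 2 $ 2) + of_int (N $ 3 $ 2))
           + x $ 3 * (c1 * of_int (N $ 1 $ 3) + c2 * of_int (N $ 2 $ 3) + of_int (N $ 3 $ 3))"
          unfolding row[symmetric] by (simp add: algebra_simps)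
        also have "\<dots> = of_real g * (x $ 1 * c1 + x $ 2 * c2 + x $ 3)"
          unfolding e by (simp add: algebra_simps)
        finally have "(z - of_real g) * (x $ 1 * c1 + x $ 2 * c2 + x $ 3) = 0" by (simp add: algebra_simps)
        moreover have "z \<noteq> of_real g" using nz pos[OF l] by (auto simp: g_def)
        ultimately show ?thesis by (simp add: c1_def c2_def)
      qed
      have "x $ 1 * (of_real l2 * of_real l3) - x $ 2 * (of_real l2 + of_real l3) + x $ 3 = 0"
        "x $ 1 * (of_real l1 * of_real l3) - x $ 2 * (of_real l1 + of_real l3) + x $ 3 = 0"
        "x $ 1 * (of_real l1 * of_real l2) - x $ 2 * (of_real l1 + of_real l2) + x $ 3 = 0"
        using U[of l1] U[of l2] U[of l3] unfolding vieta(1,2)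
        by (simp_all add: algebra_simps power2_eq_square)
      then have "x $ 1 = 0" "x $ 2 = 0" "x $ 3 = 0"
        using lagrange_coordinates[where p = "complex_of_real l1" and q = "of_real l2" and r = "of_real l3"
          and x = "x $ 1" and y = "x $ 2" and z = "x $ 3"] distinct
        by simp_all
      then show "x = 0" by (simp add: vec_eq_iff forall_3)
    qed
    then have "invertible ?Z"
      using matrix_left_invertible_ker[of ?Z] invertible_left_inverse[of ?Z] by blast
    then have "det ?Z \<noteq> 0" by (simp add: invertible_det_nz)
    then show False using z by (simp add: poly_charpoly)
  qed
  then show ?thesis using assms(1,2) by (simp add: Xi_bar_def)
qed

text \<open>The coefficients of \<open>u l\<close> form an eigenvector of the transpose of
  \<open>N\<close>, so \<open>u l (act N B)\<close> is an eigenvalue of \<open>N\<close>.\<close>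

lemma Xi_bar_pos:
  assumes N: "N \<in> Xi_bar M" and l: "l \<in> R"
  shows "0 < u l (act N B)"
proof -
  define g where "g = u l (act N B)"
  define c :: "real^3" where "c = vector [l^2 + of_int n * l + of_int m, l + of_int n, 1]"
  have comm: "N ** M = M ** N" using N by (simp add: Xi_bar_def)
  let ?Z = "mat g - map_matrix of_int N :: real^3^3"
  have "transpose ?Z *v c = 0"
    using left_eigen[OF comm l, of 1] left_eigen[OF comm l, of 2] left_eigen[OF comm l, of 3]
    by (simp add: vec_eq_iff forall_3 matrix_vector_mult_def sum_3 transpose_def mat_def c_def g_def algebra_simps)
  moreover have "c \<noteq> 0" by (auto simp: c_def vec_eq_iff forall_3)
  ultimately have "\<not> invertible (transpose ?Z)"
    using matrix_left_invertible_ker[of "transpose ?Z"] invertible_left_inverse[of "transpose ?Z"] by blast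
  then have "det ?Z = 0" by (simp add: invertible_det_nz det_transpose)
  then have "complex_of_real (det ?Z) = 0" by simp
  moreover have "det (mat (of_real g) - map_matrix of_int N :: complex^3^3) = of_real (det ?Z)"
    by (simp add: det_3 mat_def)
  ultimately have "poly (map_poly of_int (charpoly N)) (complex_of_real g) = 0"
    by (simp add: poly_charpoly)
  then have "0 < Re (complex_of_real g)" using N unfolding Xi_bar_def by blast
  then show ?thesis by (simp add: g_def)
qed

lemma Xi_bar_commutes: "N \<in> Xi_bar M \<Longrightarrow> N ** M = M ** N"
  by (simp add: Xi_bar_def)

lemma Xi_bar_one: "mat 1 \<in> Xi_bar M"
  by (rule Xi_barI) (simp_all add: act_one)

lemma Xi_bar_mult:
  assumes N: "N \<in> Xi_bar M" and N': "N' \<in> Xi_bar M"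
  shows "N ** N' \<in> Xi_bar M"
proof (rule Xi_barI)
  show "det (N ** N') = 1" using assms by (simp add: Xi_bar_def det_mul)
  show "(N ** N') ** M = M ** (N ** N')"
    using Xi_bar_commutes[OF N] Xi_bar_commutes[OF N'] by (metis matrix_mul_assoc)
  show "0 < u l (act (N ** N') B)" if l: "l \<in> R" for l
    using u_act[OF Xi_bar_commutes[OF N] l, of "act N' B"] Xi_bar_pos[OF N l] Xi_bar_pos[OF N' l]
    by (simp add: act_mult)
qed

lemma Xi_bar_inverse:
  assumes N: "N \<in> Xi_bar M"
  obtains N' where "N' \<in> Xi_bar M" "N ** N' = mat 1" "N' ** N = mat 1"
proof -
  have "det N = 1" using N by (simp add: Xi_bar_def)
  then obtain N' where N': "N ** N' = mat 1" "N' ** N = mat 1" by (rule det_one_imp_inverse)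
  have "N' \<in> Xi_bar M"
  proof (rule Xi_barI)
    show "det N' = 1" using det_mul[of N N'] N'(1) \<open>det N = 1\<close> by simp
    have "N' ** M = N' ** M ** (N ** N')" by (simp add: N')
    also have "\<dots> = N' ** (N ** M) ** N'" by (simp add: Xi_bar_commutes[OF N] matrix_mul_assoc)
    also have "\<dots> = M ** N'" by (simp add: N' matrix_mul_assoc)
    finally show "N' ** M = M ** N'" .
    show "0 < u l (act N' B)" if l: "l \<in> R" for l
    proof -
      have "u l (act N B) * u l (act N' B) = 1"
        using u_act[OF Xi_bar_commutes[OF N] l, of "act N' B"]
        by (simp add: act_mult[symmetric] N' act_one)
      then show ?thesis using Xi_bar_pos[OF N l] by (metis zero_less_mult_pos zero_less_one)
    qed
  qed
  then show ?thesis using that N' by blast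
qed

end

section \<open>The two units and the levels of integer points\<close>

text \<open>With \<open>p = x1 - (b+1) x2\<close>, \<open>y = x2\<close>, \<open>z = x3\<close>, the
  hypotheses \<open>h1\<close> to \<open>h3\<close> state \<open>ell1\<close> \<ge> 1 at
  \<open>x\<close>, \<open>act beta x\<close> and \<open>act ialpha x\<close>, the levels of the
  three neighbours of \<open>BDC\<close>. The equality case lists the lattice points of
  \<open>BD\<close> and the point \<open>C\<close>.\<close>

lemma level2_arith:
  fixes a b n p y z :: int
  assumes a: "0 \<le> a" and b: "0 \<le> b" and n: "n = (a + 2) * (b + 1)"
    and h1: "1 \<le> z - (a + 1) * p" and h2: "1 \<le> z + y"
    and h3: "1 \<le> ((b + 1) * n - b) * z - (b + 1) * p - (n - 1) * y"
  shows "a + 2 \<le> (a + 2) * z - p"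
    and "(a + 2) * z - p = a + 2 \<Longrightarrow>
      p = 0 \<and> z = 1 \<and> 0 \<le> y \<and> y \<le> b + 1 \<or> p = - (a + 2) \<and> z = 0 \<and> y = 1"
proof -
  have n1: "0 < n - 1"
    using mult_mono[of 2 "a + 2" 1 "b + 1"] a b by (simp add: n)
  define r where "r = (a + 2) * z - p"
  have "a + 2 \<le> r \<and> (r = a + 2 \<longrightarrow>
      p = 0 \<and> z = 1 \<and> 0 \<le> y \<and> y \<le> b + 1 \<or> p = - (a + 2) \<and> z = 0 \<and> y = 1)"
  proof (cases "1 \<le> z")
    case True
    have z: "(a + 2) * 1 \<le> (a + 2) * z" using True a by (intro mult_left_mono) auto
    show ?thesis
    proof (cases "p \<le> 0")
      case p: True
      have "p = 0 \<and> z = 1 \<and> 0 \<le> y \<and> y \<le> b + 1" if "r = a + 2"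
      proof -
        have "(a + 2) * z = a + 2" using that p z unfolding r_def by (intro antisym) simp_all
        moreover have "p = 0" using that calculation unfolding r_def by simp
        moreover have "z = 1" using calculation(1) a by simp
        moreover have "0 \<le> y" using h2 calculation by simp
        moreover have "(n - 1) * y \<le> (n - 1) * (b + 1)" using h3 calculation by (simp add: algebra_simps)
        then have "y \<le> b + 1" using n1 by simp
        ultimately show ?thesis by simp
      qed
      then show ?thesis using p z by (auto simp: r_def)
    next
      case False
      \<comment> \<open>For positive \<open>p\<close>, \<open>h1\<close> makes \<open>z\<close>
        exceed \<open>(a + 1) * p\<close>, which outweighs the term \<open>- p\<close>.\<close>
      have "(a + 2) * ((a + 1) * p + 1) \<le> (a + 2) * z"
        using h1 a by (intro mult_left_mono) auto
      moreover have "0 < p * ((a + 2) * (a + 1) - 1)"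
        using False mult_mono[of 2 "a + 2" 1 "a + 1"] a by (intro mult_pos_pos) auto
      ultimately show ?thesis by (simp add: r_def algebra_simps)
    qed
  next
    case False
    \<comment> \<open>For \<open>z\<close> \<le> 0, eliminating \<open>y\<close> between
      \<open>h2\<close> and \<open>h3\<close> leaves an inequality divisible by
      \<open>b + 1\<close>, which bounds \<open>r\<close> from below.\<close>
    have "(n - 1) * (1 - z) \<le> (n - 1) * y" using n1 h2 by (intro mult_left_mono) auto
    then have "(b + 1) * (a + 2) \<le> (b + 1) * ((n - 1) * z + r)"
      using h3 by (simp add: r_def n algebra_simps)
    then have r: "a + 2 \<le> (n - 1) * z + r" using b by simp
    moreover have nz: "(n - 1) * z \<le> 0" using n1 False by (simp add: mult_nonneg_nonpos)
    moreover have "p = - (a + 2) \<and> z = 0 \<and> y = 1" if e: "r = a + 2"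
    proof -
      have "(n - 1) * z = 0" using r nz e by simp
      then have z: "z = 0" using n1 by simp
      moreover have p: "p = - (a + 2)" using e z by (simp add: r_def)
      moreover have "(n - 1) * y \<le> (n - 1) * 1" using h3 unfolding z p by (simp add: n algebra_simps)
      then have "y \<le> 1" using n1 by (simp only: mult_le_cancel_left_pos)
      ultimately show ?thesis using h2 by simp
    qed
    ultimately show ?thesis by auto
  qed
  then show "a + 2 \<le> (a + 2) * z - p"
    and "(a + 2) * z - p = a + 2 \<Longrightarrow>
      p = 0 \<and> z = 1 \<and> 0 \<le> y \<and> y \<le> b + 1 \<or> p = - (a + 2) \<and> z = 0 \<and> y = 1"
    by (auto simp: r_def)
qed

text \<open>On the plane of \<open>ABD\<close>, the levels of its three neighbours give the signs of
  the barycentric coordinates: \<open>h1\<close> yields \<open>p\<close> \<ge> 0, \<open>h2\<close>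
  yields \<open>y\<close> \<ge> 0, and \<open>h3\<close> yields \<open>y\<close> \<le>
  \<open>(b + 1) * (1 - p)\<close>. The lattice points of \<open>BD\<close> (\<open>p = 0\<close>)
  and \<open>A\<close> (\<open>p = 1\<close>) remain.\<close>

lemma level1_arith:
  fixes a b n p y z :: int
  assumes a: "0 \<le> a" and b: "0 \<le> b" and n: "n = (a + 2) * (b + 1)"
    and z: "z - (a + 1) * p = 1" and h1: "a + 2 \<le> (a + 2) * z - p"
    and h2: "a + 2 \<le> (a + 2) * (p + (b + 1) * y) - y + (a + 2) * z - (a + 2)^2 * p"
    and h3: "a + 2 \<le> (a + 2) * p + (a + b + 3) * z - (a + 2) * (a + b + 3) * p - y"
  shows "p = 0 \<and> z = 1 \<and> 0 \<le> y \<and> y \<le> b + 1 \<or> p = 1 \<and> z = a + 2 \<and> y = 0"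
proof -
  have z': "z = (a + 1) * p + 1" using z by simp
  have n1: "0 < n - 1"
    using mult_mono[of 2 "a + 2" 1 "b + 1"] a b by (simp add: n)
  have "0 < (a + 2) * (a + 1) - 1" using mult_mono[of 2 "a + 2" 1 "a + 1"] a by simp
  moreover have "0 \<le> ((a + 2) * (a + 1) - 1) * p" using h1 by (simp add: z' algebra_simps)
  ultimately have p: "0 \<le> p" by (simp add: zero_le_mult_iff)
  have "0 \<le> (n - 1) * y" using h2 by (simp add: z' n algebra_simps power2_eq_square)
  then have y: "0 \<le> y" using n1 by (simp add: zero_le_mult_iff)
  have y2: "y \<le> (b + 1) * (1 - p)" using h3 by (simp add: z' algebra_simps)
  then have "0 \<le> (b + 1) * (1 - p)" using y by simp
  then have "p \<le> 1" using b by (simp add: zero_le_mult_iff)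
  then consider "p = 0" | "p = 1" using p by linarith
  then show ?thesis using y y2 z' by cases auto
qed

context sail_setup
begin

lemma u_inverse: "l \<in> R \<Longrightarrow> l\<^sup>2 + of_int n * l + of_int m = 1 / l"
  using root[of l] root_nonzero[of l] by (simp add: field_simps power2_eq_square power3_eq_cube)

lemma u_A: "l \<in> R \<Longrightarrow> u l A = 1 / l + of_int (a + 2)"
  by (simp only: u_def u_inverse) (simp add: A_def)

lemma u_A_pos: "l \<in> R \<Longrightarrow> 0 < u l A"
proof -
  have "-1 < 1 / l1" using l1 by (simp add: less_divide_eq)
  then have "0 < 1 / l1 + of_int (a + 2)" using a by simp
  moreover have "0 < 1 / l2 + of_int (a + 2)" using divide_strict_right_mono_neg[OF l2(2) l2_neg] l2_neg by simp
  moreover have "0 < 1 / l3 + of_int (a + 2)" using l3 a by (simp add: add_pos_nonneg)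
  moreover assume "l \<in> R"
  ultimately show ?thesis using u_A by auto
qed

lemma u_C: "l \<in> R \<Longrightarrow> u l C = (1 / l)^2"
proof -
  assume l: "l \<in> R"
  have "(1 / l) * (1 / l) = (l\<^sup>2 + of_int n * l + of_int m) / l"
    by (simp add: u_inverse[OF l])
  also have "\<dots> = l + of_int n + of_int m * (1 / l)"
    using root_nonzero[OF l] by (simp add: field_simps power2_eq_square)
  finally show ?thesis
    unfolding u_def u_inverse[OF l] C_def by (simp add: m power2_eq_square)
qed

text \<open>\<open>alpha\<close> is \<open>M\<close> to the power -2, \<open>ialpha\<close> is
  \<open>M ** M\<close>, and \<open>beta\<close> is the inverse of \<open>M\<close> plus
  \<open>a + 2\<close> times the identity. Thus \<open>alpha\<close> and \<open>beta\<close> are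
  multiplication by \<open>t^2\<close> and \<open>t + a + 2\<close>; explicit entries reduce
  identities to algebra.\<close>

definition alpha :: "int^3^3" where
  "alpha = vector [vector [m^2 + n, m * n + 1, m], vector [m, n, 1], vector [1, 0, 0]]"
definition ialpha :: "int^3^3" where
  "ialpha = vector [vector [0, 0, 1], vector [1, - m, - n], vector [- n, m * n + 1, n^2 - m]]"
definition beta :: "int^3^3" where
  "beta = vector [vector [m + a + 2, n, 1], vector [1, a + 2, 0], vector [0, 1, a + 2]]"
definition ibeta :: "int^3^3" where
  "ibeta = vector [vector [(a + 2)^2, 1 - n * (a + 2), - (a + 2)], vector [- (a + 2), n, 1],
     vector [1, - (b + 1), 0]]"

lemmas unit_defs = alpha_def ialpha_def beta_def ibeta_def

lemma alpha_ialpha: "alpha ** ialpha = mat 1"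
  by (simp add: unit_defs vec_eq_iff forall_3 matrix_matrix_mult_def sum_3 mat_def algebra_simps power2_eq_square)

lemma beta_ibeta: "beta ** ibeta = mat 1"
  unfolding unit_defs
  by (simp add: vec_eq_iff forall_3 matrix_matrix_mult_def sum_3 mat_def m n algebra_simps power2_eq_square)

text \<open>The side pairings of the parallelogram with diagonal \<open>BD\<close>:
  \<open>alpha\<close> carries \<open>BA\<close> to \<open>CD\<close>, and \<open>beta\<close>
  carries \<open>BC\<close> to \<open>AD\<close>.\<close>

lemma alpha_B: "act alpha B = C" and beta_B: "act beta B = A" and alpha_A: "act alpha A = D"
  and beta_C: "act beta C = D"
  unfolding vertex_defs unit_defs
  by (simp_all add: vec_eq_iff forall_3 matrix_vector_mult_def sum_3 m n algebra_simps power2_eq_square)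

lemma alpha_Xi: "alpha \<in> Xi_bar M"
proof (rule Xi_barI)
  show "det alpha = 1" by (simp add: alpha_def det_3 algebra_simps power2_eq_square)
  show "alpha ** M = M ** alpha"
    by (simp add: alpha_def A_mat_def vec_eq_iff forall_3 matrix_matrix_mult_def sum_3 algebra_simps power2_eq_square)
  show "0 < u l (act alpha B)" if "l \<in> R" for l
    using root_nonzero[OF that] unfolding alpha_B u_C[OF that] by simp
qed

lemma beta_Xi: "beta \<in> Xi_bar M"
proof (rule Xi_barI)
  show "det beta = 1" unfolding beta_def by (simp add: det_3 m n algebra_simps power2_eq_square)
  show "beta ** M = M ** beta"
    by (simp add: beta_def A_mat_def vec_eq_iff forall_3 matrix_matrix_mult_def sum_3 algebra_simps power2_eq_square)
  show "0 < u l (act beta B)" if "l \<in> R" for l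
    using u_A_pos[OF that] unfolding beta_B .
qed

lemma right_inverse_Xi:
  assumes N: "N \<in> Xi_bar M" and N': "N ** N' = mat 1"
  shows "N' \<in> Xi_bar M"
proof -
  obtain K where K: "K \<in> Xi_bar M" "K ** N = mat 1" using Xi_bar_inverse[OF N] by metis
  have "N' = K ** N ** N'" using K by simp
  also have "\<dots> = K" using N' by (simp add: matrix_mul_assoc[symmetric])
  finally show ?thesis using K by simp
qed

lemmas ialpha_Xi = right_inverse_Xi[OF alpha_Xi alpha_ialpha]
lemmas ibeta_Xi = right_inverse_Xi[OF beta_Xi beta_ibeta]

lemma u_D: "l \<in> R \<Longrightarrow> u l D = u l C * u l A"
  using u_act[OF Xi_bar_commutes[OF alpha_Xi], of l A] by (simp add: alpha_A alpha_B)

text \<open>The form \<open>x1 - (b+1) x2\<close> vanishes at \<open>B\<close> and \<open>D\<close>,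
  so both planes through this edge are level sets of its combinations with \<open>x3\<close>. On
  \<open>BDC\<close> the value is \<open>a + 2\<close> instead of 1 so that \<open>ell2\<close>
  stays integral on the lattice.\<close>

definition ell1 :: "real^3 \<Rightarrow> real" where
  "ell1 x = x $ 3 - of_int (a + 1) * (x $ 1 - of_int (b + 1) * x $ 2)"
definition ell2 :: "real^3 \<Rightarrow> real" where
  "ell2 x = of_int (a + 2) * x $ 3 - (x $ 1 - of_int (b + 1) * x $ 2)"

lemma ell1_inner: "ell1 x = vector [- of_int (a + 1), of_int ((a + 1) * (b + 1)), 1] \<bullet> x"
  by (simp add: ell1_def inner_vec_def sum_3 algebra_simps)

lemma ell2_inner: "ell2 x = vector [-1, of_int (b + 1), of_int (a + 2)] \<bullet> x"
  by (simp add: ell2_def inner_vec_def sum_3 algebra_simps)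

lemma linear_ell: "linear ell1" "linear ell2"
  by (auto intro!: linearI simp: ell1_def ell2_def algebra_simps)

lemma act_units:
  "act beta x = vector [of_int (m + a + 2) * x $ 1 + of_int n * x $ 2 + x $ 3,
     x $ 1 + of_int (a + 2) * x $ 2, x $ 2 + of_int (a + 2) * x $ 3]"
  "act ialpha x = vector [x $ 3, x $ 1 - of_int m * x $ 2 - of_int n * x $ 3,
     - of_int n * x $ 1 + of_int (m * n + 1) * x $ 2 + of_int (n^2 - m) * x $ 3]"
  "act alpha x = vector [of_int (m^2 + n) * x $ 1 + of_int (m * n + 1) * x $ 2 + of_int m * x $ 3,
     of_int m * x $ 1 + of_int n * x $ 2 + x $ 3, x $ 1]"
  "act ibeta x = vector [of_int ((a + 2)^2) * x $ 1 + of_int (1 - n * (a + 2)) * x $ 2 - of_int (a + 2) * x $ 3,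
     - of_int (a + 2) * x $ 1 + of_int n * x $ 2 + x $ 3, x $ 1 - of_int (b + 1) * x $ 2]"
  by (simp_all add: unit_defs vec_eq_iff forall_3 matrix_vector_mult_def sum_3 algebra_simps)

text \<open>The levels of the other neighbours: \<open>beta\<close> and \<open>ialpha\<close> pull
  \<open>ell1\<close> back to the triangles glued to \<open>BDC\<close> along \<open>BC\<close> and
  \<open>DC\<close>; \<open>alpha\<close> and \<open>ibeta\<close> pull \<open>ell2\<close> back to
  those glued to \<open>ABD\<close> along \<open>AB\<close> and \<open>AD\<close>.\<close>

lemma ell_units:
  fixes x :: "real^3"
  defines "y \<equiv> x $ 2" and "z \<equiv> x $ 3" and "p \<equiv> x $ 1 - of_int (b + 1) * x $ 2"
  shows "ell1 (act beta x) = z + y"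
    and "ell1 (act ialpha x) = of_int ((b + 1) * n - b) * z - of_int (b + 1) * p - of_int (n - 1) * y"
    and "ell2 (act alpha x) = of_int (a + 2) * (p + of_int (b + 1) * y) - y + of_int (a + 2) * z - of_int ((a + 2)^2) * p"
    and "ell2 (act ibeta x) = of_int (a + 2) * p + of_int (a + b + 3) * z - of_int ((a + 2) * (a + b + 3)) * p - y"
  unfolding act_units ell1_def ell2_def y_def z_def p_def
  by (simp_all add: m n algebra_simps power2_eq_square)

text \<open>In the eigenbasis the coefficients of \<^term>\<open>ell1\<close> are \<open>q(l) / p'(l)\<close>, where \<open>p\<close> is the
  characteristic polynomial and \<open>q(l) = l\<^sup>2 + (a + 1)(b + 1) l - (a + 1)\<close>; modulo \<open>p\<close> one has
  \<open>l q(l) = (1 - (b + 1) l) (l + 1)\<close>, which gives the signs.\<close>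

lemma ell1_pos:
  assumes x: "x \<noteq> 0" and nonneg: "\<And>l. l \<in> R \<Longrightarrow> 0 \<le> u l x"
  shows "0 < ell1 x"
proof -
  define q where "q l = l^2 + of_int ((a + 1) * (b + 1)) * l - of_int (a + 1)" for l :: real
  have q: "l * q l = (1 - of_int (b + 1) * l) * (l + 1)" if "l \<in> R" for l
    using root[OF that] by (simp add: q_def m n algebra_simps power2_eq_square power3_eq_cube)
  have b1: "(0::real) \<le> of_int (b + 1)" using b by simp
  have "0 < 1 - of_int (b + 1) * l1" "0 < 1 - of_int (b + 1) * l2" "0 < 1 - of_int (b + 1) * l3"
    using mult_nonneg_nonpos[OF b1, of l1] mult_nonneg_nonpos[OF b1, of l2] l1 l2_neg l3
    by (simp_all add: mult.commute)
  then have "l1 * q l1 < 0" "0 < l2 * q l2" "0 < l3 * q l3"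
    using q l1 l2 l3 by (simp_all add: mult_pos_neg)
  then have "0 < q l1" "q l2 < 0" "0 < q l3"
    using l1 l2_neg l3 by (auto simp: mult_less_0_iff zero_less_mult_iff)
  moreover have "0 < (l1 - l2) * (l1 - l3)" "(l2 - l1) * (l2 - l3) < 0" "0 < (l3 - l1) * (l3 - l2)"
    using l1 l2 l2_neg l3 by (auto simp: mult_less_0_iff zero_less_mult_iff)
  ultimately have c: "0 < q l1 / ((l1 - l2) * (l1 - l3))" "0 < q l2 / ((l2 - l1) * (l2 - l3))"
     "0 < q l3 / ((l3 - l1) * (l3 - l2))"
    by (simp_all add: zero_less_divide_iff)
  have "ell1 x = q l1 / ((l1 - l2) * (l1 - l3)) * u l1 x + q l2 / ((l2 - l1) * (l2 - l3)) * u l2 x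
     + q l3 / ((l3 - l1) * (l3 - l2)) * u l3 x" (is "_ = ?c1 * _ + ?c2 * _ + ?c3 * _")
  proof -
    define s t r where "s = u l1 x / ((l1 - l2) * (l1 - l3))" and "t = u l2 x / ((l2 - l1) * (l2 - l3))"
      and "r = u l3 x / ((l3 - l1) * (l3 - l2))"
    have "ell1 x = q l1 * s + q l2 * t + q l3 * r"
      unfolding ell1_def coordinates[of x, folded s_def t_def r_def] by (simp add: q_def algebra_simps)
    then show ?thesis by (simp add: s_def t_def r_def)
  qed
  moreover have "0 \<le> ?c1 * u l1 x" "0 \<le> ?c2 * u l2 x" "0 \<le> ?c3 * u l3 x"
    using c nonneg by (simp_all only: mult_nonneg_nonneg less_imp_le insertI1 insertI2)
  moreover have "\<not> (u l1 x = 0 \<and> u l2 x = 0 \<and> u l3 x = 0)"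
    using coordinates[of x] x by (auto simp: vec_eq_iff forall_3)
  then have "0 < ?c1 * u l1 x \<or> 0 < ?c2 * u l2 x \<or> 0 < ?c3 * u l3 x"
    using c nonneg by (simp only: zero_less_mult_iff) (metis insertCI less_eq_real_def)
  ultimately show ?thesis by linarith
qed

lemma continuous_on_u: "continuous_on S (u l)"
  by (simp add: linear_continuous_on linear_conv_bounded_linear[symmetric] linear_u)

text \<open>Since every \<open>u l\<close> is 1 at \<open>B\<close>, adding a small positive
  multiple of \<open>B\<close> moves a point of the closed cone into \<open>orth\<close>.\<close>

lemma closure_orth: "closure orth = {x. \<forall>l\<in>R. 0 \<le> u l x}"
proof
  have "closed {x. \<forall>l\<in>R. 0 \<le> u l x}"
    by (auto intro!: closed_Collect_conj closed_Collect_le continuous_on_u)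
  then show "closure orth \<subseteq> {x. \<forall>l\<in>R. 0 \<le> u l x}"
    by (intro closure_minimal) (auto simp: orth_def)
  show "{x. \<forall>l\<in>R. 0 \<le> u l x} \<subseteq> closure orth"
  proof
    fix x assume x: "x \<in> {x. \<forall>l\<in>R. 0 \<le> u l x}"
    have "(\<lambda>k. x + inverse (of_nat (Suc k)) *\<^sub>R B) \<longlonglongrightarrow> x + 0 *\<^sub>R B"
      by (intro tendsto_intros LIMSEQ_inverse_real_of_nat)
    moreover have "x + inverse (of_nat (Suc k)) *\<^sub>R B \<in> orth" for k
      using x by (auto simp: orth_def linear_add[OF linear_u] linear_scale[OF linear_u] add_nonneg_pos)
    ultimately show "x \<in> closure orth"
      unfolding closure_sequential by (intro exI[of _ "\<lambda>k. x + inverse (of_nat (Suc k)) *\<^sub>R B"]) simp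
  qed
qed

section \<open>Integer points of the closed orthant and their levels\<close>

definition pts :: "(real^3) set" where "pts = integer_points \<inter> closure orth - {0}"

lemma pts_iff: "x \<in> pts \<longleftrightarrow> (\<forall>i. x $ i \<in> \<int>) \<and> (\<forall>l\<in>R. 0 \<le> u l x) \<and> x \<noteq> 0"
  by (auto simp: pts_def closure_orth integer_points_def)

lemma act_integer: "(\<And>i. x $ i \<in> \<int>) \<Longrightarrow> act N x $ j \<in> \<int>"
  by (auto simp: matrix_vector_mult_def intro!: Ints_sum Ints_mult)

lemma pts_act:
  assumes N: "N \<in> Xi_bar M" and x: "x \<in> pts"
  shows "act N x \<in> pts"
proof -
  obtain N' where "N' ** N = mat 1" using Xi_bar_inverse[OF N] by metis
  then have "act N' (act N x) = x" by (simp add: act_mult[symmetric] act_one)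
  then have "act N x \<noteq> 0" using x by (auto simp: pts_iff)
  moreover have "0 \<le> u l (act N x)" if l: "l \<in> R" for l
    using u_act[OF Xi_bar_commutes[OF N] l, of x] Xi_bar_pos[OF N l] x l by (auto simp: pts_iff)
  moreover have "act N x $ j \<in> \<int>" for j using x act_integer by (simp add: pts_iff)
  ultimately show ?thesis by (auto simp: pts_iff)
qed

lemma vertices_orth: "A \<in> orth" "B \<in> orth" "C \<in> orth" "D \<in> orth"
proof -
  have C: "0 < u l C" if "l \<in> R" for l using root_nonzero[OF that] unfolding u_C[OF that] by simp
  then have "0 < u l D" if "l \<in> R" for l using u_D[OF that] u_A_pos[OF that] that by simp
  then show "A \<in> orth" "B \<in> orth" "C \<in> orth" "D \<in> orth" using C u_A_pos by (simp_all add: orth_def)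
qed

lemma orth_integer_pts:
  assumes "x \<in> orth" "\<And>i. x $ i \<in> \<int>"
  shows "x \<in> pts"
proof -
  have "x \<noteq> 0" using assms(1) linear_0[OF linear_u] by (auto simp: orth_def)
  then show ?thesis using assms by (auto simp: pts_iff orth_def less_imp_le)
qed

lemma vertices_pts: "A \<in> pts" "B \<in> pts" "C \<in> pts" "D \<in> pts"
proof -
  have "\<forall>i. A $ i \<in> \<int>" "\<forall>i. B $ i \<in> \<int>" "\<forall>i. C $ i \<in> \<int>" "\<forall>i. D $ i \<in> \<int>"
    by (simp_all add: vertex_defs forall_3)
  then show "A \<in> pts" "B \<in> pts" "C \<in> pts" "D \<in> pts" using vertices_orth orth_integer_pts by blast+
qed

lemma ell1_ge: "x \<in> pts \<Longrightarrow> 1 \<le> ell1 x"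
proof -
  assume x: "x \<in> pts"
  then have "ell1 x \<in> \<int>" by (simp add: ell1_def pts_iff)
  moreover have "0 < ell1 x" using x by (intro ell1_pos) (auto simp: pts_iff)
  ultimately show ?thesis by (metis Ints_cases of_int_0_less_iff of_int_1_le_iff zless_imp_add1_zle add_0)
qed

text \<open>The first coordinate is sheared so that the form vanishing at \<open>B\<close> and
  \<open>D\<close> becomes the integer parameter \<open>p\<close>.\<close>

lemma pts_cases:
  assumes "x \<in> pts"
  obtains p y z :: int where "x $ 1 = of_int (p + (b + 1) * y)" "x $ 2 = of_int y" "x $ 3 = of_int z"
proof -
  obtain k y z where "x $ 1 = of_int k" "x $ 2 = of_int y" "x $ 3 = of_int z"
    using assms unfolding pts_iff by (meson Ints_cases)
  then show ?thesis using that[of "k - (b + 1) * y" y z] by simp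
qed

text \<open>The group preserves \<open>pts\<close>, so \<open>ell1_ge\<close> also applies at
  \<open>act beta x\<close> and \<open>act ialpha x\<close>; the rest is
  \<open>level2_arith\<close>.\<close>

lemma ell2_level:
  assumes x: "x \<in> pts"
    and c: "x $ 1 = of_int (p + (b + 1) * y)" "x $ 2 = of_int y" "x $ 3 = of_int z"
  shows "of_int (a + 2) \<le> ell2 x"
    and "ell2 x = of_int (a + 2) \<Longrightarrow>
      p = 0 \<and> z = 1 \<and> 0 \<le> y \<and> y \<le> b + 1 \<or> p = - (a + 2) \<and> z = 0 \<and> y = 1"
proof -
  have p: "x $ 1 - of_int (b + 1) * x $ 2 = of_int p" by (simp add: c)
  have "(1::real) \<le> of_int (z - (a + 1) * p)"
    using ell1_ge[OF x] unfolding ell1_def p c by simp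
  moreover have "(1::real) \<le> of_int (z + y)"
    using ell1_ge[OF pts_act[OF beta_Xi x]] unfolding ell_units c by simp
  moreover have "(1::real) \<le> of_int (((b + 1) * n - b) * z - (b + 1) * p - (n - 1) * y)"
    using ell1_ge[OF pts_act[OF ialpha_Xi x]] unfolding ell_units p c by simp
  ultimately have h: "1 \<le> z - (a + 1) * p" "1 \<le> z + y" "1 \<le> ((b + 1) * n - b) * z - (b + 1) * p - (n - 1) * y"
    by (simp_all only: of_int_1_le_iff)
  have e: "ell2 x = of_int ((a + 2) * z - p)" unfolding ell2_def p c by simp
  show "of_int (a + 2) \<le> ell2 x" unfolding e of_int_le_iff by (rule level2_arith(1)[OF a b n h])
  show "ell2 x = of_int (a + 2) \<Longrightarrow>
      p = 0 \<and> z = 1 \<and> 0 \<le> y \<and> y \<le> b + 1 \<or> p = - (a + 2) \<and> z = 0 \<and> y = 1"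
    unfolding e of_int_eq_iff by (rule level2_arith(2)[OF a b n h])
qed

lemma ell2_ge:
  assumes x: "x \<in> pts"
  shows "of_int (a + 2) \<le> ell2 x"
  by (rule pts_cases[OF x]) (rule ell2_level(1)[OF x])

text \<open>The roles are now exchanged: \<open>ell2_ge\<close> at \<open>x\<close>,
  \<open>act alpha x\<close> and \<open>act ibeta x\<close> confines the points of level 1.\<close>

lemma ell1_level:
  assumes x: "x \<in> pts"
    and c: "x $ 1 = of_int (p + (b + 1) * y)" "x $ 2 = of_int y" "x $ 3 = of_int z"
    and e: "ell1 x = 1"
  shows "p = 0 \<and> z = 1 \<and> 0 \<le> y \<and> y \<le> b + 1 \<or> p = 1 \<and> z = a + 2 \<and> y = 0"
proof -
  have p: "x $ 1 - of_int (b + 1) * x $ 2 = of_int p" by (simp add: c)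
  have "of_int (z - (a + 1) * p) = (1::real)"
    using e unfolding ell1_def p c by simp
  then have 1: "z - (a + 1) * p = 1" by (simp only: of_int_eq_1_iff)
  have "real_of_int (a + 2) \<le> of_int ((a + 2) * z - p)"
    using ell2_ge[OF x] unfolding ell2_def p c by simp
  moreover have "real_of_int (a + 2) \<le> of_int ((a + 2) * (p + (b + 1) * y) - y + (a + 2) * z - (a + 2)^2 * p)"
    using ell2_ge[OF pts_act[OF alpha_Xi x]] unfolding ell_units p c by simp
  moreover have "real_of_int (a + 2) \<le> of_int ((a + 2) * p + (a + b + 3) * z - (a + 2) * (a + b + 3) * p - y)"
    using ell2_ge[OF pts_act[OF ibeta_Xi x]] unfolding ell_units p c by simp
  ultimately show ?thesis unfolding of_int_le_iff by (rule level1_arith[OF a b n 1])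
qed

end

section \<open>The orthant and the two triangular faces\<close>

context sail_setup
begin

definition eigvec :: "real \<Rightarrow> real^3" where "eigvec l = vector [1, l, l^2]"

lemma eigenvector_eigvec: "l \<in> R \<Longrightarrow> eigenvector M (eigvec l)"
proof -
  assume "l \<in> R"
  then have "1 - of_int m * l - of_int n * l^2 = l^3" using root[of l] by simp
  then have "act M (eigvec l) = l *\<^sub>R eigvec l"
    by (simp add: A_mat_def eigvec_def vec_eq_iff forall_3 matrix_vector_mult_def sum_3
        power2_eq_square power3_eq_cube)
  moreover have "eigvec l \<noteq> 0" by (auto simp: eigvec_def vec_eq_iff forall_3)
  ultimately show ?thesis by (auto simp: eigenvector_def)
qed

lemma span_eigvecs:
  assumes "p \<in> R" "q \<in> R" "p \<noteq> q"
  shows "span {eigvec p, eigvec q} \<in> eigenplanes M"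
proof -
  have "eigvec q \<notin> span {eigvec p}"
    using assms(3) by (auto simp: span_singleton eigvec_def vec_eq_iff forall_3)
  then show ?thesis using eigenvector_eigvec assms unfolding eigenplanes_def by blast
qed

text \<open>An eigenvector is annihilated by \<open>u l\<close> for every root other than its
  eigenvalue, so some \<open>u l\<close> annihilates both generators of a plane. Conversely,
  \<open>u l x = 0\<close> means that \<open>x\<close> lacks one eigenbasis coordinate.\<close>

lemma Union_eigenplanes: "\<Union>(eigenplanes M) = {x. \<exists>l\<in>R. u l x = 0}"
proof
  show "\<Union>(eigenplanes M) \<subseteq> {x. \<exists>l\<in>R. u l x = 0}"
  proof clarify
    fix P x assume "P \<in> eigenplanes M" and x: "x \<in> P"
    then obtain v w where P: "P = span {v, w}" and v: "eigenvector M v" and w: "eigenvector M w"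
      unfolding eigenplanes_def by blast
    have eig: "\<exists>k. \<forall>l\<in>R. l \<noteq> k \<longrightarrow> u l v = 0" if ev: "eigenvector M v" for v
    proof -
      obtain k where "act M v = k *\<^sub>R v" using ev by (auto simp: eigenvector_def)
      then have "l * u l v = k * u l v" if "l \<in> R" for l
        using u_act_M[OF that, of v] by (auto simp: linear_scale[OF linear_u])
      then show ?thesis by (metis mult_cancel_right)
    qed
    obtain k where k: "\<forall>l\<in>R. l \<noteq> k \<longrightarrow> u l v = 0" using eig[OF v] by blast
    obtain k' where k': "\<forall>l\<in>R. l \<noteq> k' \<longrightarrow> u l w = 0" using eig[OF w] by blast
    obtain l where "l \<in> R" "l \<noteq> k" "l \<noteq> k'" using distinct by (metis insertCI)
    then have "l \<in> R" "u l x = 0"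
      using k k' x linear_eq_0_on_span[OF linear_u, of "{v, w}" l x] unfolding P by blast+
    then show "\<exists>l\<in>R. u l x = 0" by blast
  qed
  show "{x. \<exists>l\<in>R. u l x = 0} \<subseteq> \<Union>(eigenplanes M)"
  proof clarify
    fix x l assume l: "l \<in> R" "u l x = 0"
    define s t r where "s = u l1 x / ((l1 - l2) * (l1 - l3))" and "t = u l2 x / ((l2 - l1) * (l2 - l3))"
      and "r = u l3 x / ((l3 - l1) * (l3 - l2))"
    have x: "x = s *\<^sub>R eigvec l1 + t *\<^sub>R eigvec l2 + r *\<^sub>R eigvec l3"
      using coordinates[of x] unfolding s_def t_def r_def
      by (simp add: vec_eq_iff forall_3 eigvec_def)
    have in_span: "c *\<^sub>R v + d *\<^sub>R w \<in> span {v, w}" for c d and v w :: "real^3"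
      by (simp add: span_add span_base span_scale)
    have "s = 0 \<or> t = 0 \<or> r = 0" using l by (auto simp: s_def t_def r_def)
    then have "x \<in> span {eigvec l2, eigvec l3} \<or> x \<in> span {eigvec l1, eigvec l3} \<or> x \<in> span {eigvec l1, eigvec l2}"
      using in_span[of t "eigvec l2" r "eigvec l3"] in_span[of s "eigvec l1" r "eigvec l3"]
        in_span[of s "eigvec l1" t "eigvec l2"] x by auto
    then show "x \<in> \<Union>(eigenplanes M)" using span_eigvecs distinct by blast
  qed
qed

lemma convex_orth: "convex orth"
proof -
  have "orth = (\<Inter>l\<in>R. u l -` {0<..})" by (auto simp: orth_def)
  then show ?thesis by (simp only:) (intro convex_INT convex_linear_vimage linear_u convex_real_interval)
qed

text \<open>No \<open>u l\<close> changes sign on a connected set avoiding the planes; the other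
  inclusion holds because \<open>orth\<close> is convex.\<close>

lemma orthant_at_B: "orthant_at M B = orth"
proof
  let ?S = "- {x. \<exists>l\<in>R. u l x = 0}"
  show "orthant_at M B \<subseteq> orth"
  proof
    fix y assume "y \<in> orthant_at M B"
    then obtain T where T: "connected T" "T \<subseteq> ?S" "B \<in> T" "y \<in> T"
      unfolding orthant_at_def Union_eigenplanes connected_component_def by blast
    have "0 < u l y" if l: "l \<in> R" for l
    proof (rule ccontr)
      assume "\<not> 0 < u l y"
      moreover have "connected (u l ` T)"
        using T(1) continuous_on_u by (rule connected_continuous_image[rotated])
      then have "{u l y..u l B} \<subseteq> u l ` T"
        using imageI[OF T(4), of "u l"] imageI[OF T(3), of "u l"] by (rule connected_contains_Icc)
      ultimately have "0 \<in> u l ` T" by auto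
      then show False using T(2) l by force
    qed
    then show "y \<in> orth" by (simp add: orth_def)
  qed
  show "orth \<subseteq> orthant_at M B"
    unfolding orthant_at_def Union_eigenplanes
    using vertices_orth(2) convex_connected[OF convex_orth]
    by (rule connected_component_maximal) (auto simp: orth_def)
qed

section \<open>The hull and its symmetries\<close>

definition H :: "(real^3) set" where "H = sail_hull orth"

lemma H_eq: "H = convex hull pts"
  by (simp add: H_def sail_hull_def pts_def)

lemma pts_H: "x \<in> pts \<Longrightarrow> x \<in> H"
  by (simp add: H_eq hull_inc)

lemma convex_H: "convex H"
  by (simp add: H_eq)

lemma inj_act: "N \<in> Xi_bar M \<Longrightarrow> inj (act N)"
proof (rule injI)
  fix x y assume N: "N \<in> Xi_bar M" and eq: "act N x = act N y"
  obtain N' where N': "N' ** N = mat 1" using Xi_bar_inverse[OF N] by metis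
  have "act (N' ** N) x = act (N' ** N) y" unfolding act_mult eq ..
  then show "x = y" unfolding N' act_one .
qed

lemma linear_act: "linear (act N)"
  by simp

lemma act_pts: "N \<in> Xi_bar M \<Longrightarrow> act N ` pts = pts"
proof -
  assume N: "N \<in> Xi_bar M"
  obtain N' where N': "N' \<in> Xi_bar M" "N ** N' = mat 1" using Xi_bar_inverse[OF N] by metis
  have "x = act N (act N' x)" for x using N'(2) by (simp add: act_mult[symmetric] act_one)
  then show ?thesis using pts_act[OF N] pts_act[OF N'(1)] by (auto intro: image_eqI)
qed

lemma act_H: "N \<in> Xi_bar M \<Longrightarrow> act N ` H = H"
  unfolding H_eq convex_hull_linear_image[OF linear_act] by (simp add: act_pts)

section \<open>The two triangles and the cones over them\<close>

lemma b1_pos: "0 < real_of_int b + 1" and a1_pos: "0 < real_of_int a + 2" and n_pos: "1 < real_of_int n"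
proof -
  have "1 < n" using mult_mono[of 2 "a + 2" 1 "b + 1"] a b by (simp add: n)
  then show "1 < real_of_int n" by simp
qed (use a b in simp_all)

text \<open>The edge \<open>BD\<close> contains \<open>b\<close> lattice points besides its ends;
  \<open>y / (b + 1)\<close> is the position along it.\<close>

lemma BD_points:
  assumes "x $ 1 = of_int ((b + 1) * y)" "x $ 2 = of_int y" "x $ 3 = 1" "0 \<le> y" "y \<le> b + 1"
  shows "x \<in> convex hull {B, D}"
proof -
  define s where "s = real_of_int y / of_int (b + 1)"
  have "0 \<le> s" "s \<le> 1" using assms(4,5) b by (simp_all add: s_def divide_le_eq)
  moreover have "s * (of_int b + 1) = of_int y" using b1_pos by (simp add: s_def)
  then have "x = (1 - s) *\<^sub>R B + s *\<^sub>R D"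
    using assms(1-3) by (simp add: vertex_defs vec_eq_iff forall_3 power2_eq_square mult.commute flip: mult.assoc)
  ultimately show ?thesis unfolding convex_hull_2
    by (intro CollectI exI[of _ "1 - s"] exI[of _ s]) simp
qed

lemma ell1_vertices: "ell1 A = 1" "ell1 B = 1" "ell1 D = 1"
  by (simp_all add: ell1_def vertex_defs algebra_simps power2_eq_square)

lemma ell2_vertices: "ell2 B = of_int (a + 2)" "ell2 D = of_int (a + 2)" "ell2 C = of_int (a + 2)"
  by (simp_all add: ell2_def vertex_defs algebra_simps power2_eq_square)

text \<open>The plane \<open>ell1 = 1\<close> supports \<open>H\<close>, so it cuts out the hull of
  the lattice points on it, and \<open>ell1_level\<close> places all of these in the
  triangle.\<close>

lemma face_ABD: "convex hull {A, B, D} face_of H"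
proof -
  let ?S = "pts \<inter> {x. ell1 x = 1}"
  have "?S \<subseteq> convex hull {A, B, D}"
  proof
    fix x assume x: "x \<in> ?S"
    obtain p y z where c: "x $ 1 = of_int (p + (b + 1) * y)" "x $ 2 = of_int y" "x $ 3 = of_int z"
      using x pts_cases by blast
    consider "p = 0" "z = 1" "0 \<le> y" "y \<le> b + 1" | "p = 1" "z = a + 2" "y = 0"
      using ell1_level[OF _ c] x by auto
    then show "x \<in> convex hull {A, B, D}"
    proof cases
      case 1
      then have "x \<in> convex hull {B, D}" using c by (intro BD_points) auto
      then show ?thesis using hull_mono[of "{B, D}" "{A, B, D}" convex] by auto
    next
      case 2
      then have "x = A" using c by (simp add: vec_eq_iff forall_3 A_def)
      then show ?thesis by (simp add: hull_inc)
    qed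
  qed
  then have "convex hull ?S \<subseteq> convex hull {A, B, D}" by (simp add: hull_minimal)
  moreover have "convex hull {A, B, D} \<subseteq> convex hull ?S"
    by (rule hull_mono) (simp add: vertices_pts ell1_vertices)
  moreover have "convex hull ?S face_of H"
    unfolding H_eq ell1_inner by (rule exposed_face_convex_hull) (simp only: ell1_inner[symmetric] ell1_ge)
  ultimately show ?thesis by (metis subset_antisym)
qed

lemma face_BDC: "convex hull {B, D, C} face_of H"
proof -
  let ?S = "pts \<inter> {x. ell2 x = of_int (a + 2)}"
  have "?S \<subseteq> convex hull {B, D, C}"
  proof
    fix x assume x: "x \<in> ?S"
    obtain p y z where c: "x $ 1 = of_int (p + (b + 1) * y)" "x $ 2 = of_int y" "x $ 3 = of_int z"
      using x pts_cases by blast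
    consider "p = 0" "z = 1" "0 \<le> y" "y \<le> b + 1" | "p = - (a + 2)" "z = 0" "y = 1"
      using ell2_level(2)[OF _ c] x by auto
    then show "x \<in> convex hull {B, D, C}"
    proof cases
      case 1
      then have "x \<in> convex hull {B, D}" using c by (intro BD_points) auto
      then show ?thesis using hull_mono[of "{B, D}" "{B, D, C}" convex] by auto
    next
      case 2
      then have "x = C" using c by (simp add: vec_eq_iff forall_3 C_def)
      then show ?thesis by (simp add: hull_inc)
    qed
  qed
  then have "convex hull ?S \<subseteq> convex hull {B, D, C}" by (simp add: hull_minimal)
  moreover have "convex hull {B, D, C} \<subseteq> convex hull ?S"
    by (rule hull_mono) (simp only: vertices_pts ell2_vertices insert_subset Int_iff mem_Collect_eq, simp)
  moreover have "convex hull ?S face_of H"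
    unfolding H_eq ell2_inner
    by (rule exposed_face_convex_hull) (simp only: ell2_inner[symmetric] ell2_ge)
  ultimately show ?thesis by (metis subset_antisym)
qed

lemma independent_ABD: "independent {A, B, D}"
proof (rule independent_by_functionals)
  \<comment> \<open>Up to positive factors, these are the conic coordinates belonging to
    \<open>A\<close>, \<open>B\<close> and \<open>D\<close>.\<close>
  define f g h :: "real^3 \<Rightarrow> real" where "f x = x $ 1 - of_int (b + 1) * x $ 2"
    and "g x = of_int (b + 1) * x $ 3 - of_int n * (x $ 1 - of_int (b + 1) * x $ 2) - x $ 2"
    and "h x = x $ 2" for x
  have lin: "linear f" "linear g" "linear h"
    by (auto intro!: linearI simp: f_def g_def h_def algebra_simps)
  have val: "f A \<noteq> 0" "f B = 0" "f D = 0" "g A = 0" "g B \<noteq> 0" "g D = 0" "h A = 0" "h B = 0" "h D \<noteq> 0"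
    using b1_pos unfolding f_def g_def h_def vertex_defs by (simp_all add: n algebra_simps power2_eq_square)
  show "\<exists>f::real^3 \<Rightarrow> real. linear f \<and> f v \<noteq> 0 \<and> (\<forall>w \<in> {A, B, D} - {v}. f w = 0)" if "v \<in> {A, B, D}" for v
    using that lin val by blast
qed

lemma independent_BDC: "independent {B, D, C}"
proof (rule independent_by_functionals)
  \<comment> \<open>Up to nonzero factors, these are the conic coordinates belonging to
    \<open>C\<close>, \<open>B\<close> and \<open>D\<close>.\<close>
  define f g h :: "real^3 \<Rightarrow> real" where "f x = x $ 1 - of_int (b + 1) * x $ 2"
    and "g x = of_int n * x $ 3 - (x $ 1 - of_int (b + 1) * x $ 2) - of_int (a + 2) * x $ 2"
    and "h x = of_int (a + 2) * x $ 2 + (x $ 1 - of_int (b + 1) * x $ 2)" for x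
  have lin: "linear f" "linear g" "linear h"
    by (auto intro!: linearI simp: f_def g_def h_def algebra_simps)
  have "g B = of_int n" "h D = of_int n" "f C = - of_int (a + 2)"
    unfolding f_def g_def h_def vertex_defs by (simp_all add: n algebra_simps power2_eq_square)
  then have nz: "g B \<noteq> 0" "h D \<noteq> 0" "f C \<noteq> 0" using a1_pos n_pos by auto
  have "f B = 0" "f D = 0" "g C = 0" "g D = 0" "h C = 0" "h B = 0"
    unfolding f_def g_def h_def vertex_defs by (simp_all add: n algebra_simps power2_eq_square)
  then show "\<exists>f::real^3 \<Rightarrow> real. linear f \<and> f v \<noteq> 0 \<and> (\<forall>w \<in> {B, D, C} - {v}. f w = 0)" if "v \<in> {B, D, C}" for v
    using that lin nz by blast
qed

text \<open>The first three inequalities are nonnegativity of the conic coordinates, cleared of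
  denominators. As \<open>ell1\<close> is 1 at each vertex, the coordinates add up to
  \<open>ell1 x\<close>, and dividing by it gives a convex combination.\<close>

lemma cone_ABD:
  fixes x :: "real^3"
  defines "y \<equiv> x $ 2" and "z \<equiv> x $ 3" and "p \<equiv> x $ 1 - of_int (b + 1) * x $ 2"
  assumes "0 \<le> p" "0 \<le> y" "0 \<le> of_int (b + 1) * z - of_int n * p - y" and s: "0 < ell1 x"
  obtains q where "q \<in> convex hull {A, B, D}" "x = ell1 x *\<^sub>R q"
proof -
  define k where "k = real_of_int b + 1"
  have k: "0 < k" "of_int (b + 1) = k" "of_int ((b + 1)^2) = k * k" "of_int n = of_int (a + 2) * k"
    using b by (simp_all add: k_def n power2_eq_square)
  define cA cB cD where "cA = p" and "cB = z - of_int (a + 2) * p - y / k" and "cD = y / k"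
  have cD: "cD * k = y" using k by (simp add: cD_def)
  have "k * cB = of_int (b + 1) * z - of_int n * p - y"
    using cD unfolding k cB_def cD_def[symmetric] by (simp add: algebra_simps)
  then have "0 \<le> k * cB" using assms by simp
  then have pos: "0 \<le> cA" "0 \<le> cB" "0 \<le> cD"
    using assms k(1) by (simp_all add: cA_def cD_def zero_le_mult_iff)
  have "x $ 1 = p + cD * (k * k)" "x $ 2 = cD * k" "x $ 3 = of_int (a + 2) * p + cB + cD"
    unfolding mult.assoc[symmetric] cD by (simp_all add: p_def y_def z_def cB_def cD_def k_def mult.commute)
  then have x: "x = cA *\<^sub>R A + cB *\<^sub>R B + cD *\<^sub>R D"
    unfolding vertex_defs k cA_def by (simp add: vec_eq_iff forall_3 mult.commute)
  have sum: "ell1 x = cA + cB + cD"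
    by (subst x) (simp add: linear_add[OF linear_ell(1)] linear_scale[OF linear_ell(1)] ell1_vertices)
  let ?q = "(cA / ell1 x) *\<^sub>R A + (cB / ell1 x) *\<^sub>R B + (cD / ell1 x) *\<^sub>R D"
  have "cA / ell1 x + cB / ell1 x + cD / ell1 x = 1"
    using s unfolding add_divide_distrib[symmetric] sum[symmetric] by simp
  then have "?q \<in> convex hull {A, B, D}"
    unfolding convex_hull_3 using pos s
    by (intro CollectI exI[of _ "cA / ell1 x"] exI[of _ "cB / ell1 x"] exI[of _ "cD / ell1 x"]) simp
  moreover have "ell1 x *\<^sub>R ?q = cA *\<^sub>R A + cB *\<^sub>R B + cD *\<^sub>R D"
    using s by (simp add: scaleR_add_right)
  ultimately show ?thesis using that x by metis
qed

text \<open>The same argument as for \<open>cone_ABD\<close>, with \<open>s\<close> being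
  \<open>ell2\<close> normalised to 1 at the vertices.\<close>

lemma cone_BDC:
  fixes x :: "real^3"
  defines "y \<equiv> x $ 2" and "z \<equiv> x $ 3" and "p \<equiv> x $ 1 - of_int (b + 1) * x $ 2"
    and "s \<equiv> ell2 x / of_int (a + 2)"
  assumes "p \<le> 0" "0 \<le> of_int (a + 2) * y + p" "0 \<le> of_int n * z - p - of_int (a + 2) * y" and s: "0 < s"
  obtains q where "q \<in> convex hull {B, D, C}" "x = s *\<^sub>R q"
proof -
  define k where "k = real_of_int b + 1"
  define h where "h = real_of_int a + 2"
  have k: "0 < k" "of_int (b + 1) = k" "of_int ((b + 1)^2) = k * k" "of_int (b - a - 1) = k - h"
    using b by (simp_all add: k_def h_def power2_eq_square)
  have h: "0 < h" "of_int (a + 2) = h" "of_int n = h * k" using a by (simp_all add: h_def k_def n)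
  define cC cD cB where "cC = - p / h" and "cD = (h * y + p) / (h * k)" and "cB = z - cD"
  have cC: "cC * h = - p" using h by (simp add: cC_def)
  have hcD: "h * (cD * k) = h * y + p" using h k by (simp add: cD_def)
  also have "\<dots> = h * (y - cC)" using cC by (simp add: algebra_simps)
  finally have cD: "cD * k = y - cC" using h by simp
  have "(h * k) * cB = of_int n * z - p - of_int (a + 2) * y"
    using hcD unfolding h cB_def by (simp add: algebra_simps)
  then have "0 \<le> (h * k) * cB" using assms by simp
  moreover have "0 < h * k" using h k by simp
  ultimately have pos: "0 \<le> cB" "0 \<le> cC" "0 \<le> cD"
    using assms(5,6) h(1,2) by (auto simp: zero_le_mult_iff cC_def cD_def divide_le_0_iff)
  have "x $ 1 = cD * k * k + cC * (k - h)"
    unfolding cD right_diff_distrib cC by (simp add: p_def y_def k_def algebra_simps)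
  then have x: "x = cB *\<^sub>R B + cD *\<^sub>R D + cC *\<^sub>R C"
    unfolding vertex_defs k using cD by (simp add: vec_eq_iff forall_3 cB_def y_def z_def mult.assoc)
  have "ell2 x = of_int (a + 2) * (cB + cD + cC)"
    by (subst x) (simp only: linear_add[OF linear_ell(2)] linear_scale[OF linear_ell(2)] ell2_vertices,
        simp add: algebra_simps)
  then have sum: "s = cB + cD + cC" using a by (simp add: s_def)
  let ?q = "(cB / s) *\<^sub>R B + (cD / s) *\<^sub>R D + (cC / s) *\<^sub>R C"
  have "cB / s + cD / s + cC / s = 1"
    using s unfolding add_divide_distrib[symmetric] sum[symmetric] by simp
  then have "?q \<in> convex hull {B, D, C}"
    unfolding convex_hull_3 using pos s
    by (intro CollectI exI[of _ "cB / s"] exI[of _ "cD / s"] exI[of _ "cC / s"]) simp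
  moreover have "s *\<^sub>R ?q = cB *\<^sub>R B + cD *\<^sub>R D + cC *\<^sub>R C"
    using s by (simp add: scaleR_add_right)
  ultimately show ?thesis using that x by metis
qed

end

section \<open>Covering the hull by cones\<close>

context sail_setup
begin

lemma ell_ge_H: "x \<in> H \<Longrightarrow> 1 \<le> ell1 x" "x \<in> H \<Longrightarrow> of_int (a + 2) \<le> ell2 x"
proof -
  have "pts \<subseteq> ell1 -` {1..}" "pts \<subseteq> ell2 -` {of_int (a + 2)..}"
    using ell1_ge ell2_ge by (simp_all only: subset_iff vimage_eq atLeast_iff) blast+
  moreover have "convex (ell1 -` {1..})" "convex (ell2 -` {of_int (a + 2)..})"
    by (simp_all only: convex_linear_vimage linear_ell convex_real_interval)
  ultimately have "H \<subseteq> ell1 -` {1..}" "H \<subseteq> ell2 -` {of_int (a + 2)..}"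
    unfolding H_eq by (simp_all only: hull_minimal)
  then show "x \<in> H \<Longrightarrow> 1 \<le> ell1 x" "x \<in> H \<Longrightarrow> of_int (a + 2) \<le> ell2 x"
    by (simp_all only: subset_iff vimage_eq atLeast_iff)
qed

text \<open>Every point of the hull is brought into the cone over one of the two triangles by the unit
  minimising the normalised level of the triangle: passing to the neighbour across an edge does
  not decrease the level, which says precisely that the conic coordinate of the vertex opposite
  to that edge is nonnegative.\<close>

lemma cone_cover:
  assumes x: "x \<in> H"
  obtains N q s where "N \<in> Xi_bar M" "1 \<le> s" "act N x = s *\<^sub>R q"
    "q \<in> convex hull {A, B, D} \<or> q \<in> convex hull {B, D, C}"
proof -
  \<comment> \<open>The Boolean selects a translate of \<open>ABD\<close> (\<open>True\<close>) or
    of \<open>BDC\<close>; the factor \<open>a + 2\<close> gives both the same normalisation and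
    keeps the values at \<open>pts\<close> integral.\<close>
  define L where "L i x = (case i of (N, t) \<Rightarrow> if t then of_int (a + 2) * ell1 (act N x) else ell2 (act N x))"
    for i :: "(int^3^3) \<times> bool" and x
  let ?I = "Xi_bar M \<times> (UNIV :: bool set)"
  have lin: "linear (L i)" for i
    by (cases i) (auto intro!: linearI simp: L_def linear_add[OF linear_ell(1)] linear_add[OF linear_ell(2)]
        linear_scale[OF linear_ell(1)] linear_scale[OF linear_ell(2)] algebra_simps)
  have pos: "0 \<le> L i y" if i: "i \<in> ?I" and y: "y \<in> pts" for i y
  proof -
    have "act (fst i) y \<in> pts" using pts_act i y by auto
    then have "1 \<le> ell1 (act (fst i) y)" "of_int (a + 2) \<le> ell2 (act (fst i) y)"
      by (rule ell1_ge, rule ell2_ge)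
    then show ?thesis using a by (auto simp: L_def split: prod.splits)
  qed
  have fin: "finite {L i y | i. i \<in> ?I \<and> L i y \<le> K}" if y: "y \<in> pts" for y K
  proof (rule finite_subset)
    show "{L i y | i. i \<in> ?I \<and> L i y \<le> K} \<subseteq> real_of_int ` {0..\<lfloor>K\<rfloor>}"
    proof
      fix r assume "r \<in> {L i y | i. i \<in> ?I \<and> L i y \<le> K}"
      then obtain N t where N: "(N, t) \<in> ?I" and K: "L (N, t) y \<le> K" and r: "r = L (N, t) y" by auto
      have "act N y \<in> pts" using pts_act N y by auto
      then have "L (N, t) y \<in> \<int>" by (auto simp: L_def ell1_def ell2_def pts_iff)
      then obtain k where k: "L (N, t) y = of_int k" by (auto elim: Ints_cases)
      have "0 \<le> k" "k \<le> \<lfloor>K\<rfloor>" using pos[OF N y] K unfolding k by (simp_all add: le_floor_iff)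
      then show "r \<in> real_of_int ` {0..\<lfloor>K\<rfloor>}" using k r by auto
    qed
  qed simp
  let ?i0 = "(mat 1, True) :: (int^3^3) \<times> bool"
  \<comment> \<open>Only values up to that of the identity are collected, which makes the set finite
    and nonempty; larger values cannot beat its minimum.\<close>
  let ?W = "{L i x | i. i \<in> ?I \<and> L i x \<le> L ?i0 x}"
  have finW: "finite ?W"
    by (rule finite_values_convex_hull[where S = pts, OF lin pos fin x[unfolded H_eq]])
  have "?W \<noteq> {}" using Xi_bar_one by auto
  then have "Min ?W \<in> ?W" using finW by (rule Min_in[rotated])
  then obtain i where i: "i \<in> ?I" "L i x \<le> L ?i0 x" "L i x = Min ?W" by auto
  have min: "L i x \<le> L j x" if "j \<in> ?I" for j
  proof (cases "L j x \<le> L ?i0 x")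
    case True
    then show ?thesis using Min_le[OF finW, of "L j x"] that i(3) by auto
  qed (use i(2) in simp)
  obtain N t where Nt: "i = (N, t)" by fastforce
  have N: "N \<in> Xi_bar M" using i(1) Nt by simp
  define v where "v = act N x"
  have v: "v \<in> H" using act_H[OF N] x by (auto simp: v_def)
  have min1: "L i x \<le> of_int (a + 2) * ell1 (act K v)" if "K \<in> Xi_bar M" for K
    using min[of "(K ** N, True)"] Xi_bar_mult[OF that N] by (simp add: L_def v_def act_mult)
  have min2: "L i x \<le> ell2 (act K v)" if "K \<in> Xi_bar M" for K
    using min[of "(K ** N, False)"] Xi_bar_mult[OF that N] by (simp add: L_def v_def act_mult)
  define p y z where "p = v $ 1 - of_int (b + 1) * v $ 2" and "y = v $ 2" and "z = v $ 3"
  note units = ell_units[of v, folded p_def y_def z_def]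
  have e1: "ell1 v = z - of_int (a + 1) * p" and e2: "ell2 v = of_int (a + 2) * z - p"
    by (simp_all add: ell1_def ell2_def p_def y_def z_def)
  define h k where "h = real_of_int a + 2" and "k = real_of_int b + 1"
  have hk: "0 < h" "0 < k" "of_int (a + 2) = h" "of_int (b + 1) = k" "of_int (a + 1) = h - 1"
    "of_int n = h * k" "of_int ((b + 1) * n - b) = k * (h * k) - (k - 1)" "of_int (n - 1) = h * k - 1"
    "of_int ((a + 2)^2) = h * h" "of_int (a + b + 3) = h + k" "of_int ((a + 2) * (a + b + 3)) = h * (h + k)"
    using a b by (simp_all add: h_def k_def n power2_eq_square)
  have h2: "2 \<le> h" and k1: "1 \<le> k" using a b by (simp_all add: h_def k_def)
  have hk1: "0 < h * k - 1" using n_pos hk by simp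
  have hh1: "0 < h * (h - 1) - 1" using mult_mono[of 2 h 1 "h - 1"] h2 by simp
  show ?thesis
  proof (cases t)
    case True
    have Lx: "L i x = h * ell1 v" using Nt True hk by (simp add: L_def v_def)
    \<comment> \<open>The neighbours across \<open>BD\<close>, \<open>AB\<close> and
      \<open>AD\<close> give the signs of the coordinates of \<open>A\<close>, \<open>D\<close> and
      \<open>B\<close> in turn.\<close>
    have "h * ell1 v \<le> ell2 v" using min2[OF Xi_bar_one] by (simp add: Lx act_one)
    then have "0 \<le> (h * (h - 1) - 1) * p" unfolding e1 e2 hk by (simp add: algebra_simps)
    then have p: "0 \<le> p" using hh1 by (simp add: zero_le_mult_iff)
    have "h * ell1 v \<le> ell2 (act alpha v)" using min2[OF alpha_Xi] by (simp add: Lx)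
    then have "0 \<le> (h * k - 1) * y" unfolding e1 units hk by (simp add: algebra_simps)
    then have y: "0 \<le> y" using hk1 by (simp add: zero_le_mult_iff)
    have "h * ell1 v \<le> ell2 (act ibeta v)" using min2[OF ibeta_Xi] by (simp add: Lx)
    then have z: "0 \<le> of_int (b + 1) * z - of_int n * p - y"
      unfolding e1 units hk by (simp add: algebra_simps)
    have s: "1 \<le> ell1 v" using v by (rule ell_ge_H)
    then have "0 < ell1 v" by simp
    with p y z obtain q where "q \<in> convex hull {A, B, D}" "v = ell1 v *\<^sub>R q"
      unfolding p_def y_def z_def by (rule cone_ABD)
    then show ?thesis using that[OF N s] by (auto simp: v_def)
  next
    case False
    have Lx: "L i x = ell2 v" using Nt False by (simp add: L_def v_def)
    \<comment> \<open>The neighbours across \<open>BD\<close>, \<open>BC\<close> and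
      \<open>DC\<close> give the signs of the coordinates of \<open>C\<close>, \<open>D\<close> and
      \<open>B\<close> in turn.\<close>
    have "ell2 v \<le> h * ell1 v" using min1[OF Xi_bar_one] unfolding Lx act_one hk .
    then have "0 \<le> (h * (h - 1) - 1) * - p" unfolding e1 e2 hk by (simp add: algebra_simps)
    then have p: "p \<le> 0" using hh1 by (simp add: zero_le_mult_iff mult_le_0_iff)
    have "ell2 v \<le> h * ell1 (act beta v)" using min1[OF beta_Xi] unfolding Lx hk .
    then have y: "0 \<le> of_int (a + 2) * y + p" unfolding e2 units hk by (simp add: algebra_simps)
    have "ell2 v \<le> h * ell1 (act ialpha v)" using min1[OF ialpha_Xi] unfolding Lx hk .
    then have "0 \<le> (h * k - 1) * (of_int n * z - p - of_int (a + 2) * y)"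
      unfolding e2 units hk by (simp add: algebra_simps)
    then have z: "0 \<le> of_int n * z - p - of_int (a + 2) * y" using hk1 by (simp add: zero_le_mult_iff)
    have "of_int (a + 2) \<le> ell2 v" using v by (rule ell_ge_H)
    then have s: "1 \<le> ell2 v / of_int (a + 2)" using a by (simp add: le_divide_eq)
    then have "0 < ell2 v / of_int (a + 2)" by simp
    with p y z obtain q where "q \<in> convex hull {B, D, C}" "v = (ell2 v / of_int (a + 2)) *\<^sub>R q"
      unfolding p_def y_def z_def by (rule cone_BDC)
    then show ?thesis using that[OF N s] by (auto simp: v_def)
  qed
qed

section \<open>From the cones to the faces of the boundary\<close>

lemma scale_pts: "x \<in> pts \<Longrightarrow> 0 < k \<Longrightarrow> real k *\<^sub>R x \<in> pts"
  by (auto simp: pts_iff linear_scale[OF linear_u])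

lemma orth_absorbs:
  assumes x: "x \<in> orth"
  obtains k :: nat where "0 < k" "real k *\<^sub>R x + y \<in> orth"
proof -
  have "\<exists>k::nat. - u l y < real k * u l x" if "l \<in> R" for l
    using reals_Archimedean3[of "u l x"] x that by (auto simp: orth_def)
  then obtain f :: "real \<Rightarrow> nat" where f: "\<And>l. l \<in> R \<Longrightarrow> - u l y < real (f l) * u l x"
    by metis
  define k where "k = Suc (f l1 + f l2 + f l3)"
  have "0 < u l (real k *\<^sub>R x + y)" if l: "l \<in> R" for l
  proof -
    have "real (f l) \<le> real k" using l by (auto simp: k_def)
    then have "real (f l) * u l x \<le> real k * u l x"
      using x l by (intro mult_right_mono) (auto simp: orth_def less_imp_le)
    then show ?thesis using f[OF l] by (simp add: linear_add[OF linear_u] linear_scale[OF linear_u])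
  qed
  then show ?thesis using that[of k] by (simp add: k_def orth_def)
qed

text \<open>If \<open>s > 1\<close>, a functional \<open>w\<close> supporting \<open>H\<close> at
  \<open>s\<close> times \<open>q\<close> is nonnegative on \<open>pts\<close>, which is closed
  under positive integer multiples, and nonpositive at \<open>q\<close>; so it vanishes at some
  \<open>P\<close> in \<open>V\<close>. Adding multiples of \<open>P\<close> moves every lattice
  vector into \<open>orth\<close>, hence \<open>w\<close> is nonnegative on the whole lattice and
  must be 0.\<close>

lemma boundary_level_one:
  assumes V: "V \<subseteq> orth" "V \<subseteq> pts" "q \<in> convex hull V"
    and s: "1 \<le> s" and y: "s *\<^sub>R q \<in> H" "s *\<^sub>R q \<notin> interior H"
  shows "s = 1"
proof (rule ccontr)
  assume "s \<noteq> 1"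
  then have s1: "1 < s" using s by simp
  obtain w where w: "w \<noteq> 0" "\<And>h. h \<in> H \<Longrightarrow> w \<bullet> (s *\<^sub>R q) \<le> w \<bullet> h"
    using supporting_functional[OF convex_H y] by metis
  define c where "c = w \<bullet> (s *\<^sub>R q)"
  have wpts: "0 \<le> w \<bullet> x" if x: "x \<in> pts" for x
  proof (rule ccontr)
    assume "\<not> 0 \<le> w \<bullet> x"
    then have "0 < - (w \<bullet> x)" by simp
    from reals_Archimedean3[OF this] obtain k :: nat where k: "- c < real k * (- (w \<bullet> x))" by blast
    have "real k * (- (w \<bullet> x)) \<le> real (Suc k) * (- (w \<bullet> x))"
      using \<open>\<not> 0 \<le> w \<bullet> x\<close> by (intro mult_right_mono) auto
    moreover have "c \<le> w \<bullet> (real (Suc k) *\<^sub>R x)"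
      unfolding c_def using scale_pts[OF x, of "Suc k"] by (intro w(2) pts_H) simp
    ultimately show False using k by simp
  qed
  have q: "q \<in> H" using V hull_mono[OF V(2), of convex] by (auto simp: H_eq)
  have "s * (w \<bullet> q) \<le> w \<bullet> q" using w(2)[OF q] by simp
  then have "(s - 1) * (w \<bullet> q) \<le> 0" by (simp add: algebra_simps)
  then have wq: "w \<bullet> q \<le> 0" using s1 by (simp add: mult_le_0_iff)
  have "\<exists>P\<in>V. w \<bullet> P = 0"
  proof (rule ccontr)
    assume *: "\<not> (\<exists>P\<in>V. w \<bullet> P = 0)"
    then have "V \<subseteq> {x. w \<bullet> x > 0}" using wpts V(2) by force
    then have "convex hull V \<subseteq> {x. w \<bullet> x > 0}" by (intro hull_minimal convex_halfspace_gt)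
    then show False using V(3) wq by auto
  qed
  then obtain P where P: "P \<in> orth" "P \<in> pts" "w \<bullet> P = 0" using V by blast
  have nonneg: "0 \<le> w \<bullet> v" if v: "\<And>i. v $ i \<in> \<int>" for v
  proof -
    obtain k :: nat where k: "real k *\<^sub>R P + v \<in> orth" using orth_absorbs[OF P(1)] by metis
    have "real k *\<^sub>R P + v \<in> pts"
      using k P(2) v by (intro orth_integer_pts) (auto simp: pts_iff)
    then show ?thesis using wpts P(3) by (fastforce simp: inner_add_right)
  qed
  have "w \<bullet> axis i 1 = 0" for i
  proof -
    have "0 \<le> w \<bullet> axis i 1" "0 \<le> w \<bullet> (- axis i 1)" by (intro nonneg; simp add: axis_def)+
    then show ?thesis by simp
  qed
  then have "w = 0" by (simp add: inner_axis vec_eq_iff)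
  then show False using w(1) by simp
qed

text \<open>A relative interior point \<open>x\<close> of \<open>F\<close> is moved into a triangle
  by \<open>cone_cover\<close> and \<open>boundary_level_one\<close>. \<open>V\<close> spans the
  face of the triangle with \<open>act N x\<close> in its relative interior, and faces whose
  relative interiors meet coincide.\<close>

lemma face_normal_form:
  assumes F: "F face_of H" "F \<noteq> {}" "F \<subseteq> frontier H"
  obtains N V where "N \<in> Xi_bar M" "V \<noteq> {}" "V \<subseteq> {A, B, D} \<or> V \<subseteq> {B, D, C}" "act N ` F = convex hull V"
proof -
  have "convex F" using F(1) face_of_imp_convex by blast
  then obtain x where x: "x \<in> rel_interior F" using rel_interior_eq_empty F(2) by blast
  then have xF: "x \<in> F" using rel_interior_subset by blast
  then have xH: "x \<in> H" "x \<notin> interior H" using F face_of_imp_subset by (auto simp: frontier_def)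
  obtain N q s where N: "N \<in> Xi_bar M" and s: "1 \<le> s" and q: "act N x = s *\<^sub>R q"
    "q \<in> convex hull {A, B, D} \<or> q \<in> convex hull {B, D, C}"
    using cone_cover[OF xH(1)] by metis
  define T where "T = (if q \<in> convex hull {A, B, D} then {A, B, D} else {B, D, C})"
  have T: "q \<in> convex hull T" "T = {A, B, D} \<or> T = {B, D, C}" using q(2) by (auto simp: T_def)
  have face: "convex hull T face_of H" and "independent T"
    using T(2) face_ABD face_BDC independent_ABD independent_BDC by auto
  then have indep: "\<not> affine_dependent T" using affine_dependent_imp_dependent by blast
  have "s *\<^sub>R q \<in> H" using act_H[OF N] xH(1) q(1) by (metis imageI)
  moreover have "s *\<^sub>R q \<notin> interior H"
    using interior_injective_linear_image[OF linear_act inj_act[OF N], of H] act_H[OF N] xH(2) q(1) inj_act[OF N]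
    by (metis inj_image_mem_iff)
  ultimately have "s = 1"
    using T vertices_orth vertices_pts by (intro boundary_level_one[OF _ _ T(1) s]) auto
  then have NxT: "act N x \<in> convex hull T" using q T by simp
  obtain V where V: "V \<subseteq> T" "V \<noteq> {}" "act N x \<in> rel_interior (convex hull V)"
    using simplex_rel_interior_cases[OF indep NxT] by metis
  have "convex hull V face_of convex hull T"
    using V(1) face_of_convex_hull_affine_independent[OF indep] by blast
  then have faceV: "convex hull V face_of H" using face face_of_trans by blast
  have "act N ` F face_of H"
    using F(1) face_of_linear_image[OF linear_act inj_act[OF N], of F H] act_H[OF N] by simp
  moreover have "act N x \<in> rel_interior (act N ` F)"
    using x rel_interior_injective_linear_image[OF _ inj_act[OF N], of F] by simp
  ultimately have "act N ` F = convex hull V" using faceV V(3) by (intro face_of_eq) auto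
  then show ?thesis using that[OF N V(2)] V(1) T(2) by blast
qed

end

section \<open>Inequivalence of the six faces\<close>

text \<open>Sign changes of the characteristic polynomial locate one root in each of the intervals
  from \<open>-(n+1)\<close> to \<open>-1\<close>, from \<open>-1\<close> to
  \<open>-1/(a+2)\<close>, and from \<open>0\<close> to \<open>1/(b+1)\<close>.\<close>

lemma sail_setup_exists:
  fixes a b m n :: int
  assumes a: "0 \<le> a" and b: "0 \<le> b" and m: "m = b - a - 1" and n: "n = (a + 2) * (b + 1)"
  shows "\<exists>l1 l2 l3. sail_setup a b m n l1 l2 l3"
proof -
  define p :: "real poly" where "p = [:-1, of_int m, of_int n, 1:]"
  have p: "poly p x = x^3 + of_int n * x^2 + of_int m * x - 1" for x
    by (simp add: p_def algebra_simps power2_eq_square power3_eq_cube)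
  have ab: "0 \<le> a * b" using a b by simp
  have nm: "1 \<le> n + m" "2 < n - m" "1 < n" using a b ab unfolding m n distrib_left distrib_right by linarith+
  have v1: "poly p (-1) > 0" using nm by (simp add: p flip: of_int_diff)
  have v0: "poly p 0 < 0" by (simp add: p)
  define N where "N = - real_of_int (n + 1)"
  have "poly p N = - of_int ((n + 1) * (n + 1 + m) + 1)"
    by (simp add: p N_def algebra_simps power2_eq_square power3_eq_cube)
  moreover have "0 < (n + 1) * (n + 1 + m)" using nm by (intro mult_pos_pos) linarith+
  then have "0 < (n + 1) * (n + 1 + m) + 1" by linarith
  ultimately have vN: "poly p N < 0" by (simp only: neg_less_0_iff_less of_int_0_less_iff)
  define h k where "h = real_of_int a + 2" and "k = real_of_int b + 1"
  have hk: "1 < h" "0 < k" "of_int n = h * k" "of_int m = k - h" using a b by (simp_all add: h_def k_def m n)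
  \<comment> \<open>Cancellation leaves exactly \<open>-1/h^3\<close> here, and \<open>1/k^3\<close>
    at \<open>1/k\<close>.\<close>
  have v2: "poly p (- (1 / h)) < 0"
    using hk(1) unfolding p hk by (simp add: field_simps power2_eq_square power3_eq_cube)
  have v3: "poly p (1 / k) > 0"
    using hk(2) unfolding p hk by (simp add: field_simps power2_eq_square power3_eq_cube)
  have "N < -1" using nm by (simp add: N_def)
  then obtain x where x: "x < -1" "poly p x = 0" using poly_IVT_pos[OF _ vN v1] by blast
  have "-1 < - (1 / h)" using hk(1) by simp
  then obtain y where y: "-1 < y" "y < - (1 / h)" "poly p y = 0" using poly_IVT_neg[OF _ v1 v2] by blast
  obtain z where z: "0 < z" "z < 1 / k" "poly p z = 0" using poly_IVT_pos[OF _ v0 v3] hk(2) by auto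
  have "- (1 / h) < 0" using hk(1) by simp
  then have ne: "x \<noteq> y" "x \<noteq> z" "y \<noteq> z" using x y z by linarith+
  \<comment> \<open>Vieta's formulas come from divided differences of \<open>p\<close> at the three
    distinct roots.\<close>
  have "(x - y) * (x\<^sup>2 + x * y + y\<^sup>2 + of_int n * (x + y) + of_int m) = poly p x - poly p y"
    unfolding p by algebra
  then have e1: "x\<^sup>2 + x * y + y\<^sup>2 + of_int n * (x + y) + of_int m = 0" using x y ne by simp
  have "(x - z) * (x\<^sup>2 + x * z + z\<^sup>2 + of_int n * (x + z) + of_int m) = poly p x - poly p z"
    unfolding p by algebra
  then have e2: "x\<^sup>2 + x * z + z\<^sup>2 + of_int n * (x + z) + of_int m = 0" using x z ne by simp
  have "(y - z) * (x + y + z + of_int n) = 0" using e1 e2 by algebra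
  then have n': "of_int n = - (x + y + z)" using ne by simp
  have m': "of_int m = x * y + x * z + y * z" using e1 unfolding n' by algebra
  have "x * y * z = 1" using x(2) unfolding p n' m' by algebra
  moreover have "y * of_int (a + 2) < -1" using y(2) hk(1) by (simp add: h_def field_simps)
  moreover have "z * of_int (b + 1) < 1" using z(2) hk(2) by (simp add: k_def field_simps)
  ultimately have "sail_setup a b m n x y z"
    using assms n' m' x(1) y(1) z(1) by unfold_locales
  then show ?thesis by blast
qed

context sail_setup
begin

section \<open>The six representatives\<close>

definition vertex_sets :: "(real^3) set set" where
  "vertex_sets = {{A}, {A, B}, {A, D}, {B, D}, {A, B, D}, {B, D, C}}"

definition open_face :: "(real^3) set \<Rightarrow> (real^3) set" where
  "open_face V = rel_interior (convex hull V)"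

lemma vertex_sets_cases: "V \<in> vertex_sets \<Longrightarrow> V \<noteq> {} \<and> (V \<subseteq> {A, B, D} \<or> V \<subseteq> {B, D, C})"
  by (auto simp: vertex_sets_def)

lemma affine_independent_subset:
  assumes "V \<subseteq> {A, B, D} \<or> V \<subseteq> {B, D, C}"
  shows "\<not> affine_dependent V"
  using assms affine_dependent_imp_dependent independent_mono[OF independent_ABD]
    independent_mono[OF independent_BDC] by blast

lemma distinct_vertices: "A \<noteq> B" "A \<noteq> D" "B \<noteq> D" "B \<noteq> C" "D \<noteq> C"
  using b by (simp_all add: vertex_defs vec_eq_iff forall_3)

lemma open_faces_eq:
  "open_face ` vertex_sets = {{A}, open_segment A B, open_segment A D, open_segment B D,
     rel_interior (convex hull {A, B, D}), rel_interior (convex hull {B, D, C})}"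
  using distinct_vertices
  by (simp add: vertex_sets_def open_face_def segment_convex_hull[symmetric] rel_interior_closed_segment)

lemma face_subset:
  assumes V: "V \<subseteq> {A, B, D} \<or> V \<subseteq> {B, D, C}"
  shows "convex hull V face_of H"
proof -
  obtain T where T: "V \<subseteq> T" "T = {A, B, D} \<or> T = {B, D, C}" using V by blast
  then have "\<not> affine_dependent T" using affine_independent_subset by auto
  then have "convex hull V face_of convex hull T"
    using face_of_convex_hull_affine_independent T(1) by blast
  then show ?thesis using T(2) face_ABD face_BDC face_of_trans by blast
qed

lemma open_face_in_sail_faces:
  assumes V: "V \<in> vertex_sets"
  shows "open_face V \<in> sail_faces orth"
proof -
  have face: "convex hull V face_of H" using face_subset vertex_sets_cases[OF V] by blast
  have sub: "convex hull V \<subseteq> H" using face by (rule face_of_imp_subset)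
  obtain T where T: "convex hull V \<subseteq> convex hull T" "T = {A, B, D} \<or> T = {B, D, C}"
    using vertex_sets_cases[OF V] hull_mono by metis
  \<comment> \<open>Twice \<open>B\<close> lies in \<open>H\<close> but off both triangle planes, so
    \<open>convex hull V\<close> is a proper face and avoids the interior of
    \<open>H\<close>.\<close>
  have "2 *\<^sub>R B \<notin> convex hull T"
  proof
    assume "2 *\<^sub>R B \<in> convex hull T"
    moreover have "convex hull {A, B, D} \<subseteq> ell1 -` {1}"
      by (intro hull_minimal convex_linear_vimage linear_ell convex_singleton) (simp add: ell1_vertices)
    moreover have "convex hull {B, D, C} \<subseteq> ell2 -` {of_int (a + 2)}"
      by (intro hull_minimal convex_linear_vimage linear_ell convex_singleton)
        (simp only: insert_subset vimage_singleton_eq ell2_vertices, simp)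
    ultimately have "ell1 (2 *\<^sub>R B) = 1 \<or> ell2 (2 *\<^sub>R B) = of_int (a + 2)"
      using T(2) by blast
    then show False
      using a1_pos by (simp add: linear_scale[OF linear_ell(1)] linear_scale[OF linear_ell(2)] ell1_vertices ell2_vertices)
  qed
  moreover have "2 *\<^sub>R B \<in> H" using scale_pts[OF vertices_pts(2), of 2] by (simp add: pts_H)
  ultimately have "convex hull V \<noteq> H" using T(1) by blast
  then have "convex hull V \<inter> interior H = {}" using face face_of_disjoint_interior by blast
  then have "convex hull V \<subseteq> frontier H" using sub closure_subset by (auto simp: frontier_def)
  then show ?thesis
    using face vertex_sets_cases[OF V] unfolding sail_faces_def open_face_def sail_def H_def by auto
qed

lemma act_inverses: "act ialpha D = A" "act ialpha C = B"
  unfolding vertex_defs unit_defs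
  by (simp_all add: vec_eq_iff forall_3 matrix_vector_mult_def sum_3 m n algebra_simps power2_eq_square)

text \<open>The faces of the two triangles left out of \<open>vertex_sets\<close> are translates:
  \<open>B\<close>, \<open>D\<close> and \<open>C\<close> of \<open>A\<close>, the edge
  \<open>BC\<close> of \<open>AD\<close>, and \<open>DC\<close> of \<open>AB\<close>.\<close>

lemma vertex_set_normal_form:
  assumes "V \<noteq> {}" "V \<subseteq> {A, B, D} \<or> V \<subseteq> {B, D, C}"
  obtains N where "N \<in> Xi_bar M" "act N ` V \<in> vertex_sets"
proof -
  have id: "act (mat 1) ` V = V" by (simp add: act_one)
  consider "V \<in> vertex_sets" | "V = {B}" | "V = {D}" | "V = {C}" | "V = {B, C}" | "V = {D, C}"
  proof -
    have "V \<in> vertex_sets \<or> V = {B} \<or> V = {D} \<or> V = {C} \<or> V = {B, C} \<or> V = {D, C}"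
      using assms(2)
    proof
      assume "V \<subseteq> {A, B, D}"
      from subset_triple[OF this] show ?thesis
        using assms(1) unfolding vertex_sets_def by (elim disjE) simp_all
    next
      assume "V \<subseteq> {B, D, C}"
      from subset_triple[OF this] show ?thesis
        using assms(1) unfolding vertex_sets_def by (elim disjE) simp_all
    qed
    then show thesis using that by blast
  qed
  then show ?thesis
  proof cases
    case 1 then show ?thesis using that[OF Xi_bar_one] id by simp
  next
    case 2 then show ?thesis using that[OF beta_Xi] by (simp add: beta_B vertex_sets_def)
  next
    case 3 then show ?thesis using that[OF ialpha_Xi] by (simp add: act_inverses vertex_sets_def)
  next
    case 4 then show ?thesis using that[OF Xi_bar_mult[OF beta_Xi ialpha_Xi]]
      by (simp add: act_mult act_inverses beta_B vertex_sets_def)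
  next
    case 5 then show ?thesis using that[OF beta_Xi] by (simp add: beta_B beta_C vertex_sets_def)
  next
    case 6 then show ?thesis using that[OF ialpha_Xi] by (simp add: act_inverses vertex_sets_def)
  qed
qed

lemma rel_interior_act: "N \<in> Xi_bar M \<Longrightarrow> rel_interior (act N ` F) = act N ` rel_interior F"
  by (simp add: rel_interior_injective_linear_image inj_act)

lemma act_open_face: "N \<in> Xi_bar M \<Longrightarrow> act N ` open_face V = open_face (act N ` V)"
  unfolding open_face_def
  by (simp only: rel_interior_act[symmetric] convex_hull_linear_image[OF linear_act])

text \<open>In logarithmic coordinates for the eigenvalues \<^term>\<open>l1\<close> and \<^term>\<open>l3\<close> the group acts by
  translations, and \<open>A\<close>, \<open>B\<close>, \<open>C\<close>, \<open>D\<close> become the vertices of a parallelogram.\<close>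

lemma vertex_sets_inequivalent:
  assumes V: "V \<in> vertex_sets" and W: "W \<in> vertex_sets" and N: "N \<in> Xi_bar M" and VW: "act N ` V = W"
  shows "V = W"
proof -
  define f g where "f x = ln (u l1 x)" and "g x = ln (u l3 x)" for x
  have val: "f B = 0" "f D = f C + f A" "g B = 0" "g D = g C + g A"
    using u_A_pos vertices_orth u_D by (simp_all add: f_def g_def orth_def ln_mult_pos)
  \<comment> \<open>The signs derived from here on place \<open>A\<close> in the open first quadrant
    and \<open>C\<close> in the second, with \<open>B\<close> at the origin and \<open>D\<close> at
    their sum.\<close>
  have t1: "-1 < 1 / l1" "1 / l1 < 0" using l1 by (simp_all add: less_divide_eq)
  have "(1 / l1)^2 < 1" using t1 by (simp add: power2_less_1_iff abs_less_iff)
  then have fC: "f C < 0" using vertices_orth(3) u_C[of l1] unfolding f_def orth_def by auto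
  have fA: "0 < f A" using t1 a u_A[of l1] unfolding f_def by (intro ln_gt_zero) simp
  have "1 < 1 / l3"
  proof -
    have "l3 * 1 \<le> l3 * of_int (b + 1)" using l3(1) b by (intro mult_left_mono) auto
    then have "l3 < 1" using l3(2) by linarith
    then show ?thesis using l3(1) by (simp add: less_divide_eq)
  qed
  then have gA: "0 < g A" and gC: "0 < g C" using a u_A[of l3] u_C[of l3] unfolding g_def
    by (auto intro!: ln_gt_zero)
  define c d where "c = f (act N B)" and "d = g (act N B)"
  have tr: "f (act N x) = c + f x" "g (act N x) = d + g x" if "x \<in> {A, B, C, D}" for x
  proof -
    have "x \<in> orth" using that vertices_orth by blast
    then show "f (act N x) = c + f x" "g (act N x) = d + g x"
      unfolding f_def g_def c_def d_def
      using u_act[OF Xi_bar_commutes[OF N], of _ x] Xi_bar_pos[OF N] by (simp_all add: orth_def ln_mult_pos)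
  qed
  have "V \<subseteq> {A, B, C, D}" using V by (auto simp: vertex_sets_def)
  then have fw: "\<forall>v\<in>V. \<exists>w\<in>W. f w = c + f v \<and> g w = d + g v"
    using VW tr by blast
  \<comment> \<open>Group elements are injective, so only vertex sets of equal size need
    comparison.\<close>
  have "card W = card V"
    using VW card_image[OF inj_on_subset[OF inj_act[OF N] subset_UNIV], of V] by simp
  moreover have card: "card {A, B} = 2" "card {A, D} = 2" "card {B, D} = 2" "card {A, B, D} = 3"
      "card {B, D, C} = 3" "card {A} = 1"
    using distinct_vertices by simp_all
  ultimately consider "V = {A}" "W = {A}"
    | "V \<in> {{A, B}, {A, D}, {B, D}}" "W \<in> {{A, B}, {A, D}, {B, D}}"
    | "V \<in> {{A, B, D}, {B, D, C}}" "W \<in> {{A, B, D}, {B, D, C}}"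
    using V W unfolding vertex_sets_def by (elim insertE emptyE; simp del: card_insert_disjoint)
  then show ?thesis
  proof cases
    case 1 then show ?thesis by simp
  next
    case 2
    show ?thesis
    proof (rule ccontr)
      assume ne: "V \<noteq> W"
      \<comment> \<open>Every matching of the vertices under the common translation
        \<open>(c, d)\<close> contradicts these signs.\<close>
      from 2 fw ne val fA fC gA gC show False
        by (elim insertE emptyE; hypsubst; simp only: ball_simps bex_simps simp_thms val; elim disjE conjE; linarith)
    qed
  next
    case 3
    show ?thesis
    proof (rule ccontr)
      assume ne: "V \<noteq> W"
      from 3 fw ne val fA fC gA gC show False
        by (elim insertE emptyE; hypsubst; simp only: ball_simps bex_simps simp_thms val; elim disjE conjE; linarith)
    qed
  qed
qed

text \<open>Existence combines \<open>face_normal_form\<close> with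
  \<open>vertex_set_normal_form\<close>. For uniqueness, two representatives in one orbit differ by
  a group element; their relative interiors determine the vertices, so
  \<open>vertex_sets_inequivalent\<close> applies.\<close>

lemma open_faces_fundamental_domain:
  "open_face ` vertex_sets \<subseteq> sail_faces orth \<and>
    fundamental_domain M orth (\<Union>(open_face ` vertex_sets))"
proof -
  have sub: "open_face ` vertex_sets \<subseteq> sail_faces orth"
    using open_face_in_sail_faces by blast
  have unique: "\<exists>!G. G \<in> open_face ` vertex_sets \<and> G \<in> face_orbit M F" if "F \<in> sail_faces orth" for F
  proof (rule ex_ex1I)
    obtain E where E: "F = rel_interior E" "E face_of H" "E \<noteq> {}" "E \<subseteq> frontier H"
      using \<open>F \<in> sail_faces orth\<close> by (auto simp: sail_faces_def sail_def H_def)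
    obtain N V where N: "N \<in> Xi_bar M" and V: "V \<noteq> {}" "V \<subseteq> {A, B, D} \<or> V \<subseteq> {B, D, C}"
      and NE: "act N ` E = convex hull V"
      using face_normal_form[OF E(2-4)] by metis
    obtain K where K: "K \<in> Xi_bar M" "act K ` V \<in> vertex_sets"
      using vertex_set_normal_form[OF V] by metis
    have "act (K ** N) ` F = act K ` (act N ` F)" by (simp add: image_image act_mult)
    also have "act N ` F = open_face V"
      unfolding E(1) open_face_def NE[symmetric] rel_interior_act[OF N] ..
    also have "act K ` open_face V = open_face (act K ` V)" by (rule act_open_face[OF K(1)])
    finally have "open_face (act K ` V) \<in> face_orbit M F"
      unfolding face_orbit_def using Xi_bar_mult[OF K(1) N] by blast
    then show "\<exists>G. G \<in> open_face ` vertex_sets \<and> G \<in> face_orbit M F" using K(2) by blast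
  next
    fix G G'
    assume "G \<in> open_face ` vertex_sets \<and> G \<in> face_orbit M F"
      and "G' \<in> open_face ` vertex_sets \<and> G' \<in> face_orbit M F"
    then obtain V W N K where V: "V \<in> vertex_sets" "G = open_face V" and W: "W \<in> vertex_sets" "G' = open_face W"
      and N: "N \<in> Xi_bar M" "G = act N ` F" and K: "K \<in> Xi_bar M" "G' = act K ` F"
      unfolding face_orbit_def by blast
    obtain K' where K': "K' \<in> Xi_bar M" "K' ** K = mat 1" using Xi_bar_inverse[OF K(1)] by metis
    let ?N = "N ** K'"
    have N': "?N \<in> Xi_bar M" using N(1) K'(1) by (rule Xi_bar_mult)
    have "act ?N ` G' = act N ` (\<lambda>x. act (K' ** K) x) ` F"
      unfolding K(2) by (simp add: image_image act_mult)
    also have "\<dots> = G" by (simp add: K'(2) act_one N(2))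
    finally have eq: "open_face (act ?N ` W) = open_face V"
      unfolding W(2) V(2) act_open_face[OF N'] .
    have "independent W"
      using vertex_sets_cases[OF W(1)] independent_mono[OF independent_ABD] independent_mono[OF independent_BDC]
      by blast
    then have "independent (act ?N ` W)"
      by (rule linear_independent_injective_image[OF linear_act _ inj_on_subset[OF inj_act[OF N'] subset_UNIV]])
    then have "\<not> affine_dependent (act ?N ` W)" using affine_dependent_imp_dependent by blast
    moreover have "\<not> affine_dependent V" using V(1) vertex_sets_cases affine_independent_subset by blast
    ultimately have "act ?N ` W = V"
      using eq unfolding open_face_def by (rule rel_interior_simplex_determines_vertices)
    then have "W = V" by (rule vertex_sets_inequivalent[OF W(1) V(1) N'])
    then show "G = G'" using V W by simp
  qed
  show ?thesis
    unfolding fundamental_domain_def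
    by (intro conjI exI[of _ "open_face ` vertex_sets"] sub refl ballI unique)
qed

end

theorem theorem5:
  fixes a b m n :: int and A B C D :: "real^3"
    and Q :: "(real^3) set" and \<F> :: "(real^3) set set"
  assumes "0 \<le> a" and "0 \<le> b"
    and "m = b - a - 1" and "n = (a + 2) * (b + 1)"
    and "A = vector [1, 0, of_int (a + 2)]"
    and "B = vector [0, 0, 1]"
    and "C = vector [of_int (b - a - 1), 1, 0]"
    and "D = vector [of_int ((b + 1)^2), of_int (b + 1), 1]"
    and "Q = orthant_at (A_mat m n) (vector [0, 0, 1])"
    and "\<F> = {{A}, open_segment A B, open_segment A D, open_segment B D,
               rel_interior (convex hull {A, B, D}), rel_interior (convex hull {B, D, C})}"
  shows "\<F> \<subseteq> sail_faces Q \<and> fundamental_domain (A_mat m n) Q (\<Union>\<F>)"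
proof -
  obtain l1 l2 l3 where "sail_setup a b m n l1 l2 l3"
    using sail_setup_exists[OF assms(1-4)] by blast
  then interpret S: sail_setup a b m n l1 l2 l3 .
  have "A = S.A" "B = S.B" "C = S.C" "D = S.D"
    by (simp_all only: assms S.vertex_defs)
  moreover have "Q = S.orth"
    unfolding assms(9) by (rule S.orthant_at_B[unfolded S.B_def])
  ultimately show ?thesis
    unfolding assms(10) using S.open_faces_fundamental_domain unfolding S.open_faces_eq by simp
qed

end
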